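(* For every integer $n\ge 0$, each of the following three generating functions is equal to the moment $\mu_{2n}(c+1)$ of the associated Hermite polynomials: (a) the generating function for rooted maps (in orientable surfaces) with $n$ edges, where every vertex has weight $c$ except the vertex at the head of the root edge, which has weight $1$; (b) the generating function for connected matchings on $2n+2$ vertices, where every non-nested edge except the edge containing vertex $1$ has weight $c$, and all other edges have weight $1$; (c) the generating function for complete matchings on $2n$ vertices in which each non-nested edge may have weight $1$ or $c$ (so it contributes a factor $1+c$), and all other edges have weight $1$.
   Context: A generating function here is the sum, over all objects, of the product of the weights of their parts; $c$ is an indeterminate. Moments: $\mu_n(c)=\sum_P wt(P)$, where $P$ runs over Dyck paths of length $n$ (paths with $n$ northeast or southeast steps from height $0$ to height $0$, never below height $0$), and $wt(P)$ is the product of its step weights, a northeast step having weight $1$ and a southeast step leaving from height $j$ having weight $j-1+c$. These are the moments of the functional for which the polynomials $H_0(x;c)=1$, $H_{n+1}(x;c)=xH_n(x;c)-(n-1+c)H_{n-1}(x;c)$ (with $H_{-1}=0$) are orthogonal. $\mu_{2n}(c+1)$ denotes the result of substituting $c+1$ for $c$. A complete matching on $2m$ vertices is a partition of $\{1,\dots,2m\}$ into edges $(a,b)$, $a<b$. An edge $(a,b)$ is nested if there is an edge $(a',b')$ with $a'<a<b<b'$, and non-nested otherwise. The matching is connected if every vertex $v$ other than $1$ and $2m$ satisfies $a<v<b$ for some edge $(a,b)$. A map in an orientable surface is a connected graph (loops and multiple edges allowed) embedded in an oriented closed surface with faces homeomorphic to discs. A rooted map is a map in which one edge has been oriented (the root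 edge); rooted maps are counted up to root-preserving (orientation-preserving) isomorphism, and there is one rooted map with $0$ edges, consisting of a single vertex, which is given weight $1$. *)

theory Defs
  imports
    "HOL-Library.Disjoint_Sets"
    "HOL-Combinatorics.Permutations"
    "HOL-Combinatorics.Orbits"
    "HOL-Computational_Algebra.Polynomial"
begin

text \<open>All generating functions live in the polynomial ring over the integers in one
  indeterminate.\<close>

abbreviation cvar :: "int poly"
  where "cvar \<equiv> [:0, 1:]"


subsection \<open>Moments of the associated Hermite polynomials\<close>

datatype step = NE | SE

definition height :: "step list \<Rightarrow> nat \<Rightarrow> int"
  where "height p i = int (count_list (take i p) NE) - int (count_list (take i p) SE)"

definition dyck_paths :: "nat \<Rightarrow> step list set"
  where "dyck_paths n = {p. length p = n \<and> (\<forall>i\<le>n. height p i \<ge> 0) \<and> height p n = 0}"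

definition path_weight :: "step list \<Rightarrow> int poly"
  where "path_weight p =
    (\<Prod>i<length p. case p ! i of NE \<Rightarrow> 1 | SE \<Rightarrow> of_int (height p i) - 1 + cvar)"

definition moment :: "nat \<Rightarrow> int poly"
  where "moment n = (\<Sum>p\<in>dyck_paths n. path_weight p)"


subsection \<open>Matchings\<close>

definition matchings :: "nat \<Rightarrow> (nat \<times> nat) set set"
  where "matchings m =
    {M. (\<forall>(a, b)\<in>M. a < b) \<and> partition_on {1..2 * m} ((\<lambda>(a, b). {a, b}) ` M)}"

definition nested :: "(nat \<times> nat) set \<Rightarrow> nat \<times> nat \<Rightarrow> bool"
  where "nested M = (\<lambda>(a, b). \<exists>(a', b')\<in>M. a' < a \<and> a < b \<and> b < b')"

definition connected_matchings :: "nat \<Rightarrow> (nat \<times> nat) set set"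
  where "connected_matchings m =
    {M \<in> matchings m. \<forall>v\<in>{1..2 * m} - {1, 2 * m}. \<exists>(a, b)\<in>M. a < v \<and> v < b}"

definition connected_matching_gf :: "nat \<Rightarrow> int poly"
  where "connected_matching_gf m =
    (\<Sum>M\<in>connected_matchings m.
      \<Prod>e\<in>M. if \<not> nested M e \<and> fst e \<noteq> 1 \<and> snd e \<noteq> 1 then cvar else 1)"

definition matching_gf :: "nat \<Rightarrow> int poly"
  where "matching_gf m =
    (\<Sum>M\<in>matchings m. \<Prod>e\<in>M. if \<not> nested M e then 1 + cvar else 1)"


subsection \<open>Rooted maps\<close>

text \<open>Maps in oriented closed surfaces are encoded in the standard way by rotation systems.
  Each edge consists of two darts (its two orientations), and a dart is attached to the vertex
  at its tail. \<open>opp\<close> reverses a dart, \<open>rot\<close> sends a dart to the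
  counterclockwise next dart with the same tail. Gluing a disc to each orbit of
  \<open>rot \<circ> opp\<close> recovers the surface, so that every face is a disc. The root edge with its
  orientation is a dart. The map consisting of a single vertex has no darts and hence no root
  dart; it is the only map whose root dart is \<open>None\<close>.\<close>

record 'd rooted_map =
  darts :: "'d set"
  rot :: "'d \<Rightarrow> 'd"
  opp :: "'d \<Rightarrow> 'd"
  root_dart :: "'d option"

definition is_rooted_map :: "'d rooted_map \<Rightarrow> bool"
  where "is_rooted_map M \<longleftrightarrow>
    finite (darts M) \<and>
    rot M permutes darts M \<and>
    opp M permutes darts M \<and>
    (\<forall>d\<in>darts M. opp M d \<noteq> d \<and> opp M (opp M d) = d) \<and>
    (\<forall>d\<in>darts M. \<forall>e\<in>darts M.
      (d, e) \<in> {(x, y). x \<in> darts M \<and> (y = rot M x \<or> y = opp M x)}\<^sup>*) \<and>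
    (case root_dart M of None \<Rightarrow> darts M = {} | Some r \<Rightarrow> r \<in> darts M)"

text \<open>An isomorphism commutes with \<open>rot\<close> itself and not with its inverse, that is, it
  preserves the orientation.\<close>

definition map_iso :: "'d rooted_map \<Rightarrow> 'e rooted_map \<Rightarrow> bool"
  where "map_iso M N \<longleftrightarrow>
    (\<exists>f. bij_betw f (darts M) (darts N) \<and>
      (\<forall>d\<in>darts M. f (rot M d) = rot N (f d) \<and> f (opp M d) = opp N (f d)) \<and>
      map_option f (root_dart M) = root_dart N)"

text \<open>Vertices are orbits of \<open>rot\<close>. The vertex of the map without edges is not
  represented, in accordance with the convention that this map has weight 1.\<close>

definition vertices :: "'d rooted_map \<Rightarrow> 'd set set"
  where "vertices M = orbit (rot M) ` darts M"

text \<open>The head of the root edge is the tail of the reversed root dart.\<close>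

definition map_weight :: "'d rooted_map \<Rightarrow> int poly"
  where "map_weight M =
    (case root_dart M of
      None \<Rightarrow> 1
    | Some r \<Rightarrow> \<Prod>v\<in>vertices M. if v = orbit (rot M) (opp M r) then 1 else cvar)"

text \<open>A map with \<open>n\<close> edges has \<open>2 * n\<close> darts, and up to isomorphism these
  may be taken to be the numbers below \<open>2 * n\<close>.\<close>

definition rooted_maps :: "nat \<Rightarrow> nat rooted_map set"
  where "rooted_maps n = {M. is_rooted_map M \<and> darts M = {..<2 * n}}"

definition iso_rel :: "nat \<Rightarrow> nat rooted_map rel"
  where "iso_rel n = {(M, N). M \<in> rooted_maps n \<and> N \<in> rooted_maps n \<and> map_iso M N}"

definition rooted_map_gf :: "nat \<Rightarrow> int poly"
  where "rooted_map_gf n =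
    (\<Sum>C\<in>rooted_maps n // iso_rel n. map_weight (SOME M. M \<in> C))"

text \<open>Isomorphism is an equivalence relation and weights are invariant, so the choice of
  representatives in the last definition is immaterial.\<close>

lemma map_iso_refl: "map_iso M M"
  unfolding map_iso_def by (rule exI[of _ id]) (simp add: option.map_id)

lemma map_iso_sym:
  assumes M: "is_rooted_map M" and iso: "map_iso M N"
  shows "map_iso N M"
proof -
  obtain f where bij: "bij_betw f (darts M) (darts N)"
    and comm: "\<And>d. d \<in> darts M \<Longrightarrow> f (rot M d) = rot N (f d) \<and> f (opp M d) = opp N (f d)"
    and rt: "map_option f (root_dart M) = root_dart N"
    using iso unfolding map_iso_def by blast
  define g where "g = inv_into (darts M) f"
  have gf: "g (f d) = d" if "d \<in> darts M" for d
    using bij that by (simp add: g_def bij_betw_inv_into_left)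
  have closed: "rot M d \<in> darts M" "opp M d \<in> darts M" if "d \<in> darts M" for d
    using M that unfolding is_rooted_map_def by (auto simp: permutes_in_image)
  have "bij_betw g (darts N) (darts M)"
    unfolding g_def by (rule bij_betw_inv_into[OF bij])
  moreover have "g (rot N e) = rot M (g e) \<and> g (opp N e) = opp M (g e)" if e: "e \<in> darts N" for e
  proof -
    obtain d where d: "d \<in> darts M" "e = f d"
      using e unfolding bij_betw_imp_surj_on[OF bij, symmetric] by (rule imageE)
    have "rot N e = f (rot M d)" "opp N e = f (opp M d)"
      using comm[OF d(1)] d(2) by simp_all
    then show ?thesis
      using gf[OF d(1)] gf[OF closed(1)[OF d(1)]] gf[OF closed(2)[OF d(1)]] d(2) by simp
  qed
  moreover have "map_option g (root_dart N) = root_dart M"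
    using M gf unfolding rt[symmetric] is_rooted_map_def by (cases "root_dart M") auto
  ultimately show ?thesis
    unfolding map_iso_def by blast
qed

lemma map_iso_trans:
  assumes "map_iso L M" and "map_iso M N"
  shows "map_iso L N"
proof -
  obtain f where f: "bij_betw f (darts L) (darts M)"
    "\<And>d. d \<in> darts L \<Longrightarrow> f (rot L d) = rot M (f d) \<and> f (opp L d) = opp M (f d)"
    "map_option f (root_dart L) = root_dart M"
    using assms(1) unfolding map_iso_def by blast
  obtain g where g: "bij_betw g (darts M) (darts N)"
    "\<And>d. d \<in> darts M \<Longrightarrow> g (rot M d) = rot N (g d) \<and> g (opp M d) = opp N (g d)"
    "map_option g (root_dart M) = root_dart N"
    using assms(2) unfolding map_iso_def by blast
  have "f d \<in> darts M" if "d \<in> darts L" for d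
    using f(1) that by (rule bij_betwE[rule_format])
  then have "\<forall>d\<in>darts L.
      (g \<circ> f) (rot L d) = rot N ((g \<circ> f) d) \<and> (g \<circ> f) (opp L d) = opp N ((g \<circ> f) d)"
    using f(2) g(2) by simp
  moreover have "map_option (g \<circ> f) (root_dart L) = root_dart N"
    unfolding option.map_comp[symmetric] f(3) g(3) ..
  ultimately show ?thesis
    unfolding map_iso_def using bij_betw_trans[OF f(1) g(1)] by blast
qed

lemma equiv_iso_rel: "equiv (rooted_maps n) (iso_rel n)"
proof (rule equivI)
  show "iso_rel n \<subseteq> rooted_maps n \<times> rooted_maps n"
    unfolding iso_rel_def by blast
  show "refl_on (rooted_maps n) (iso_rel n)"
    unfolding iso_rel_def by (rule refl_onI) (simp add: map_iso_refl)
  show "sym (iso_rel n)"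
    unfolding iso_rel_def rooted_maps_def by (rule symI) (blast intro: map_iso_sym)
  show "trans (iso_rel n)"
    unfolding iso_rel_def by (rule transI) (blast intro: map_iso_trans)
qed

lemma map_weight_cong:
  assumes M: "is_rooted_map M" and iso: "map_iso M N"
  shows "map_weight M = map_weight N"
proof -
  obtain f where bij: "bij_betw f (darts M) (darts N)"
    and comm: "\<And>d. d \<in> darts M \<Longrightarrow> f (rot M d) = rot N (f d) \<and> f (opp M d) = opp N (f d)"
    and rt: "map_option f (root_dart M) = root_dart N"
    using iso unfolding map_iso_def by blast
  have perm: "rot M permutes darts M" and closed_opp: "\<And>d. d \<in> darts M \<Longrightarrow> opp M d \<in> darts M"
    using M unfolding is_rooted_map_def by (auto simp: permutes_in_image)
  have sub: "orbit (rot M) d \<subseteq> darts M" if "d \<in> darts M" for d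
    using permutes_orbit_subset[OF perm that] .
  have orb: "f ` orbit (rot M) d = orbit (rot N) (f d)" if d: "d \<in> darts M" for d
  proof
    show "f ` orbit (rot M) d \<subseteq> orbit (rot N) (f d)"
    proof clarify
      fix x assume "x \<in> orbit (rot M) d"
      then show "f x \<in> orbit (rot N) (f d)"
      proof induction
        case base
        show ?case using comm[OF d] orbit.base[of "rot N" "f d"] by simp
      next
        case (step x)
        have "x \<in> darts M" using sub[OF d] step.hyps by (rule subsetD)
        then show ?case using comm orbit.step[OF step.IH] by simp
      qed
    qed
    show "orbit (rot N) (f d) \<subseteq> f ` orbit (rot M) d"
    proof
      fix y assume "y \<in> orbit (rot N) (f d)"
      then show "y \<in> f ` orbit (rot M) d"
      proof induction
        case base
        have "rot N (f d) = f (rot M d)" using comm[OF d] by simp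
        then show ?case by (rule image_eqI) (rule orbit.base)
      next
        case (step y)
        from step.IH obtain x where x: "x \<in> orbit (rot M) d" "y = f x" by (rule imageE)
        then have "rot N y = f (rot M x)" using comm[OF subsetD[OF sub[OF d] x(1)]] by simp
        then show ?case by (rule image_eqI) (rule orbit.step[OF x(1)])
      qed
    qed
  qed
  show ?thesis
  proof (cases "root_dart M")
    case None
    then show ?thesis using rt unfolding map_weight_def by auto
  next
    case (Some r)
    then have r: "r \<in> darts M" and rN: "root_dart N = Some (f r)"
      using M rt unfolding is_rooted_map_def by auto
    have vsub: "v \<subseteq> darts M" if "v \<in> vertices M" for v
      using that sub unfolding vertices_def by auto
    have inj: "inj_on ((`) f) (Pow (darts M))"
      by (rule inj_on_image_Pow[OF bij_betw_imp_inj_on[OF bij]])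
    have V: "vertices N = (`) f ` vertices M"
    proof -
      have "vertices N = orbit (rot N) ` f ` darts M"
        using bij unfolding vertices_def bij_betw_def by simp
      also have "\<dots> = (`) f ` vertices M"
        unfolding vertices_def image_image by (rule image_cong) (simp_all add: orb)
      finally show ?thesis .
    qed
    let ?h = "orbit (rot M) (opp M r)"
    have hd: "orbit (rot N) (opp N (f r)) = f ` ?h"
      using orb[OF closed_opp[OF r]] comm[OF r] by simp
    have "map_weight N = (\<Prod>v\<in>(`) f ` vertices M. if v = f ` ?h then 1 else cvar)"
      unfolding map_weight_def rN V option.case hd ..
    also have "\<dots> = (\<Prod>v\<in>vertices M. if f ` v = f ` ?h then 1 else cvar)"
    proof -
      have "inj_on ((`) f) (vertices M)"
        by (intro inj_on_subset[OF inj] subsetI PowI vsub)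
      then show ?thesis by (simp add: prod.reindex)
    qed
    also have "\<dots> = (\<Prod>v\<in>vertices M. if v = ?h then 1 else cvar)"
    proof (rule prod.cong)
      fix v assume "v \<in> vertices M"
      then have "f ` v = f ` ?h \<longleftrightarrow> v = ?h"
        by (intro inj_on_eq_iff[OF inj] PowI vsub sub closed_opp r)
      then show "(if f ` v = f ` ?h then 1 else cvar) = (if v = ?h then 1 else cvar)" by simp
    qed simp
    also have "\<dots> = map_weight M"
      unfolding map_weight_def Some by simp
    finally show ?thesis by simp
  qed
qed

lemma map_weight_respects: "map_weight respects iso_rel n"
  unfolding congruent_def iso_rel_def rooted_maps_def by (blast intro: map_weight_cong)

end

theory Submission
  imports Defs
begin

text \<open>With \<open>c + 1\<close> in place of \<open>c\<close>, a southeast step from height \<open>j\<close> has weight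
  \<open>j + c\<close>.

  Reading a matching from left to right, an opener is a northeast step and a closer at height
  \<open>j\<close> chooses one of the \<open>j\<close> open vertices; its edge is non-nested exactly if it takes the
  leftmost one. A closer thus contributes \<open>j - 1 + x\<close> if non-nested edges have weight \<open>x\<close>.
  For (c), take \<open>x = 1 + c\<close>. For (b), take \<open>x = c\<close>: connectedness means that the height is
  positive strictly inside the path, and lowering the inner path by 1 turns the weights
  \<open>j - 1 + c\<close> into \<open>j + c\<close>. Counting the (always non-nested) edge at vertex 1 with weight
  \<open>c\<close> as well only multiplies the generating function by \<open>c\<close>.

  For (a), rooted maps have no automorphisms, so unlabelled maps with \<open>n\<close> edges may be
  replaced by labelled ones, that is, by transitive pairs of a permutation and a fixed point free
  involution of \<open>2 * n\<close> darts. Splitting off the component of a fixed dart from an arbitrary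
  such pair expresses the generating function of transitive pairs as a quotient of two explicit
  series, whose continued fraction expansion (of Gauss type) is the one of the moments.\<close>

subsection \<open>Moments as path sums\<close>

text \<open>The recursion removes the last step of a path from height 0 to height \<open>h\<close>.
  A final southeast step leaves from height \<open>h + 1\<close>, whose weight
  \<open>(h + 1) - 1 + y\<close> is \<open>h + y\<close>. The semiring is arbitrary because these
  sums are needed both for polynomials and for elements of a field.\<close>

fun path_sum :: "'a::comm_semiring_1 \<Rightarrow> nat \<Rightarrow> nat \<Rightarrow> 'a" where
  "path_sum y 0 h = (if h = 0 then 1 else 0)"
| "path_sum y (Suc k) h =
    (case h of 0 \<Rightarrow> 0 | Suc h' \<Rightarrow> path_sum y k h') + (of_nat h + y) * path_sum y k (Suc h)"

definition dyck_prefixes :: "nat \<Rightarrow> nat \<Rightarrow> step list set"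
  where "dyck_prefixes k h = {p. length p = k \<and> (\<forall>i\<le>k. height p i \<ge> 0) \<and> height p k = int h}"

lemma dyck_paths_eq: "dyck_paths n = dyck_prefixes n 0"
  by (simp add: dyck_paths_def dyck_prefixes_def)

lemma finite_dyck_prefixes: "finite (dyck_prefixes k h)"
proof (rule finite_subset)
  show "dyck_prefixes k h \<subseteq> {p. set p \<subseteq> {NE, SE} \<and> length p = k}"
    by (auto simp: dyck_prefixes_def) (metis step.exhaust)
  show "finite {p. set p \<subseteq> {NE, SE} \<and> length p = k}"
    by (rule finite_lists_length_eq) simp
qed

lemma height_append: "i \<le> length p \<Longrightarrow> height (p @ q) i = height p i"
  by (simp add: height_def)

lemma height_snoc:
  "height (p @ [s]) (Suc (length p)) = height p (length p) + (if s = NE then 1 else - 1)"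
  by (cases s) (simp_all add: height_def)

lemma path_weight_snoc:
  "path_weight (p @ [s]) =
    path_weight p * (case s of NE \<Rightarrow> 1 | SE \<Rightarrow> of_int (height p (length p)) - 1 + cvar)"
proof -
  have "path_weight (p @ [s]) =
    (\<Prod>i<length p. case (p @ [s]) ! i of NE \<Rightarrow> 1 | SE \<Rightarrow> of_int (height (p @ [s]) i) - 1 + cvar)
    * (case s of NE \<Rightarrow> 1 | SE \<Rightarrow> of_int (height (p @ [s]) (length p)) - 1 + cvar)"
    by (simp add: path_weight_def)
  also have "(\<Prod>i<length p. case (p @ [s]) ! i of NE \<Rightarrow> 1 | SE \<Rightarrow> of_int (height (p @ [s]) i) - 1 + cvar)
     = path_weight p"
    unfolding path_weight_def
    by (rule prod.cong) (auto simp: nth_append height_append split: step.split)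
  finally show ?thesis by (simp add: height_append split: step.split)
qed

lemma dyck_prefixes_Suc:
  "dyck_prefixes (Suc k) h =
    (\<lambda>p. p @ [NE]) ` (case h of 0 \<Rightarrow> {} | Suc h' \<Rightarrow> dyck_prefixes k h')
    \<union> (\<lambda>p. p @ [SE]) ` dyck_prefixes k (Suc h)" (is "_ = ?R")
proof (intro set_eqI iffI)
  fix q assume q: "q \<in> dyck_prefixes (Suc k) h"
  then obtain p s where ps: "q = p @ [s]" and len: "length p = k"
    by (auto simp: dyck_prefixes_def length_Suc_conv_rev)
  have nonneg: "\<forall>i\<le>k. height p i \<ge> 0"
  proof (intro allI impI)
    fix i assume "i \<le> k"
    then have "i \<le> Suc k" "i \<le> length p" using len by simp_all
    then show "height p i \<ge> 0"
      using q height_append[of i p "[s]"] unfolding dyck_prefixes_def ps by fastforce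
  qed
  have last: "height p k + (if s = NE then 1 else - 1) = int h"
    using q height_snoc[of p s] len by (simp add: dyck_prefixes_def ps)
  show "q \<in> ?R"
  proof (cases s)
    case NE
    then obtain h' where "h = Suc h'" "height p k = int h'"
      using last nonneg[rule_format, of k] by (cases h) auto
    then show ?thesis using NE ps len nonneg by (auto simp: dyck_prefixes_def)
  next
    case SE
    then have "height p k = int (Suc h)" using last by simp
    then show ?thesis using SE ps len nonneg by (auto simp: dyck_prefixes_def)
  qed
next
  fix q assume "q \<in> ?R"
  then show "q \<in> dyck_prefixes (Suc k) h"
    by (auto simp: dyck_prefixes_def le_Suc_eq height_append height_snoc split: nat.splits)
qed

lemma path_weight_sum: "(\<Sum>p\<in>dyck_prefixes k h. path_weight p) = path_sum cvar k h"
proof (induction k arbitrary: h)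
  case 0
  have "dyck_prefixes 0 h = (if h = 0 then {[]} else {})"
    by (auto simp: dyck_prefixes_def height_def)
  then show ?case by (simp add: path_weight_def)
next
  case (Suc k)
  let ?A = "case h of 0 \<Rightarrow> {} | Suc h' \<Rightarrow> dyck_prefixes k h'"
  have fin: "finite ?A" by (simp add: finite_dyck_prefixes split: nat.split)
  have "(\<Sum>p\<in>dyck_prefixes (Suc k) h. path_weight p) =
      (\<Sum>p\<in>?A. path_weight (p @ [NE])) + (\<Sum>p\<in>dyck_prefixes k (Suc h). path_weight (p @ [SE]))"
    unfolding dyck_prefixes_Suc
    by (subst sum.union_disjoint) (auto simp: fin finite_dyck_prefixes sum.reindex inj_on_def)
  also have "(\<Sum>p\<in>?A. path_weight (p @ [NE])) = (case h of 0 \<Rightarrow> 0 | Suc h' \<Rightarrow> path_sum cvar k h')"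
    by (simp add: path_weight_snoc Suc.IH split: nat.split)
  also have "(\<Sum>p\<in>dyck_prefixes k (Suc h). path_weight (p @ [SE])) =
      (\<Sum>p\<in>dyck_prefixes k (Suc h). (of_nat h + cvar) * path_weight p)"
    by (rule sum.cong) (auto simp: path_weight_snoc dyck_prefixes_def algebra_simps)
  also have "\<dots> = (of_nat h + cvar) * path_sum cvar k (Suc h)"
    by (simp only: Suc.IH flip: sum_distrib_left)
  finally show ?case by simp
qed

lemma pcompose_path_sum: "pcompose (path_sum y k h) q = path_sum (pcompose y q) k h"
proof (induction k arbitrary: h)
  case 0
  then show ?case by (simp add: pcompose_1)
next
  case (Suc k)
  have "pcompose (of_nat h) q = of_nat h" by (induction h) (simp_all add: pcompose_add pcompose_1)
  then show ?case by (simp add: pcompose_add pcompose_mult Suc.IH split: nat.split)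
qed

lemma moment_shift: "pcompose (moment n) (cvar + 1) = path_sum (cvar + 1) n 0"
  unfolding moment_def dyck_paths_eq path_weight_sum pcompose_path_sum
  by (simp add: pcompose_pCons)

text \<open>Serves to pass from polynomials to their values: \<open>f\<close> is a semiring
  homomorphism, and the recursion only uses sums, products and natural numbers.\<close>

lemma path_sum_hom:
  fixes f :: "'a::comm_semiring_1 \<Rightarrow> 'b::comm_semiring_1"
  assumes "\<And>a b. f (a + b) = f a + f b" "\<And>a b. f (a * b) = f a * f b" "f 0 = 0" "f 1 = 1"
  shows "f (path_sum y k h) = path_sum (f y) k h"
proof (induction k arbitrary: h)
  case 0
  then show ?case by (simp add: assms)
next
  case (Suc k)
  have "f (of_nat m) = of_nat m" for m by (induction m) (simp_all add: assms)
  then show ?case by (simp add: assms Suc.IH split: nat.split)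
qed

subsection \<open>Partial matchings\<close>

definition ends :: "(nat \<times> nat) set \<Rightarrow> nat set"
  where "ends M = (\<Union>(a, b)\<in>M. {a, b})"

definition open_vertices :: "nat \<Rightarrow> (nat \<times> nat) set \<Rightarrow> nat set"
  where "open_vertices k M = {1..k} - ends M"

text \<open>What is visible of a matching after its first \<open>k\<close> vertices: the edges with
  both ends seen, while the \<open>h\<close> open vertices wait for partners further right. Thus
  \<open>h\<close> is the height of the corresponding Dyck prefix.\<close>

definition partial_matchings :: "nat \<Rightarrow> nat \<Rightarrow> (nat \<times> nat) set set"
  where "partial_matchings k h = {M. (\<forall>(a, b)\<in>M. a < b) \<and> ends M \<subseteq> {1..k} \<and>
    (\<forall>e\<in>M. \<forall>e'\<in>M. {fst e, snd e} \<inter> {fst e', snd e'} \<noteq> {} \<longrightarrow> e = e') \<and>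
    card (open_vertices k M) = h}"

text \<open>An open vertex is going to be matched to the right of all vertices seen so far, so it nests
  every edge that starts after it.\<close>

definition nested_partial :: "nat \<Rightarrow> (nat \<times> nat) set \<Rightarrow> nat \<times> nat \<Rightarrow> bool"
  where "nested_partial k M e \<longleftrightarrow> nested M e \<or> (\<exists>u\<in>open_vertices k M. u < fst e)"

definition partial_weight :: "'a::comm_semiring_1 \<Rightarrow> nat \<Rightarrow> (nat \<times> nat) set \<Rightarrow> 'a"
  where "partial_weight x k M = (\<Prod>e\<in>M. if nested_partial k M e then 1 else x)"

text \<open>The second disjunct anticipates the future edge of an open vertex \<open>u\<close>,
  whose right end lies beyond \<open>k\<close>.\<close>

definition covered :: "nat \<Rightarrow> (nat \<times> nat) set \<Rightarrow> nat \<Rightarrow> bool"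
  where "covered k M v \<longleftrightarrow> (\<exists>(a, b)\<in>M. a < v \<and> v < b) \<or> (\<exists>u\<in>open_vertices k M. u < v)"

lemma ends_insert: "ends (insert (a, b) M) = {a, b} \<union> ends M"
  by (simp add: ends_def)

lemma ends_memI: "(a, b) \<in> M \<Longrightarrow> a \<in> ends M" "(a, b) \<in> M \<Longrightarrow> b \<in> ends M"
  by (auto simp: ends_def)

lemma partial_matchings_subset: "M \<in> partial_matchings k h \<Longrightarrow> M \<subseteq> {1..k} \<times> {1..k}"
  by (force simp: partial_matchings_def ends_def)

lemma finite_partial_matchings: "finite (partial_matchings k h)"
proof (rule finite_subset)
  show "partial_matchings k h \<subseteq> Pow ({1..k} \<times> {1..k})"
    using partial_matchings_subset by blast
qed simp

lemma finite_partial_matching: "M \<in> partial_matchings k h \<Longrightarrow> finite M"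
  by (rule finite_subset[OF partial_matchings_subset]) simp_all

lemma finite_open_vertices [simp]: "finite (open_vertices k M)"
  by (simp add: open_vertices_def)

lemma open_vertices_Suc:
  assumes "ends M \<subseteq> {1..k}"
  shows "open_vertices (Suc k) M = insert (Suc k) (open_vertices k M)"
  using assms by (auto simp: open_vertices_def)

lemma open_vertices_insert:
  assumes "ends M \<subseteq> {1..k}" "a \<in> open_vertices k M"
  shows "open_vertices (Suc k) (insert (a, Suc k) M) = open_vertices k M - {a}"
  using assms by (auto simp: open_vertices_def ends_insert)

lemma partial_matchings_Suc_open:
  assumes "ends M \<subseteq> {1..k}"
  shows "M \<in> partial_matchings (Suc k) h \<longleftrightarrow> (\<exists>h'. h = Suc h' \<and> M \<in> partial_matchings k h')"
proof -
  have "card (open_vertices (Suc k) M) = Suc (card (open_vertices k M))"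
    unfolding open_vertices_Suc[OF assms] by (subst card_insert_disjoint) (auto simp: open_vertices_def)
  moreover have "ends M \<subseteq> {1..Suc k}" using assms by auto
  ultimately show ?thesis using assms by (auto simp: partial_matchings_def)
qed

lemma partial_matchings_Suc_insert:
  assumes M: "M \<in> partial_matchings k (Suc h)" and a: "a \<in> open_vertices k M"
  shows "insert (a, Suc k) M \<in> partial_matchings (Suc k) h"
proof -
  have e: "ends M \<subseteq> {1..k}" and ak: "a \<in> {1..k}" "a \<notin> ends M"
    using M a by (auto simp: partial_matchings_def open_vertices_def)
  have sk: "Suc k \<notin> ends M" using e by auto
  have "card (open_vertices (Suc k) (insert (a, Suc k) M)) = h"
    unfolding open_vertices_insert[OF e a]
    using M a by (simp add: partial_matchings_def)
  moreover have "ends (insert (a, Suc k) M) \<subseteq> {1..Suc k}"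
    using e ak by (auto simp: ends_insert)
  moreover have "\<forall>e\<in>insert (a, Suc k) M. \<forall>e'\<in>insert (a, Suc k) M.
      {fst e, snd e} \<inter> {fst e', snd e'} \<noteq> {} \<longrightarrow> e = e'"
  proof -
    have new: "{fst e, snd e} \<inter> {a, Suc k} = {}" if "e \<in> M" for e
      using that ak(2) sk ends_memI[of "fst e" "snd e" M] by auto
    have old: "\<forall>e\<in>M. \<forall>e'\<in>M. {fst e, snd e} \<inter> {fst e', snd e'} \<noteq> {} \<longrightarrow> e = e'"
      using M by (simp add: partial_matchings_def)
    show ?thesis
    proof (intro ballI impI)
      fix e e' assume meet: "{fst e, snd e} \<inter> {fst e', snd e'} \<noteq> {}"
        and mem: "e \<in> insert (a, Suc k) M" "e' \<in> insert (a, Suc k) M"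
      consider "e = (a, Suc k)" "e' = (a, Suc k)" | "e = (a, Suc k)" "e' \<in> M"
        | "e \<in> M" "e' = (a, Suc k)" | "e \<in> M" "e' \<in> M"
        using mem by blast
      then show "e = e'"
      proof cases
        case 2
        then show ?thesis using new[of e'] meet by (simp add: Int_commute)
      next
        case 3
        then show ?thesis using new[of e] meet by simp
      next
        case 4
        then show ?thesis using old meet by blast
      qed simp
    qed
  qed
  moreover have "\<forall>(x, y)\<in>insert (a, Suc k) M. x < y"
    using M ak by (simp add: partial_matchings_def)
  ultimately show ?thesis by (simp add: partial_matchings_def)
qed

text \<open>Since \<open>Suc k\<close> is the largest possible end, it can only be the right end of
  its edge; removing that edge reopens its left end.\<close>

lemma partial_matchings_Suc_remove:
  assumes M: "M \<in> partial_matchings (Suc k) h" and s: "Suc k \<in> ends M"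
  obtains a N where "M = insert (a, Suc k) N" "N \<in> partial_matchings k (Suc h)"
    "a \<in> open_vertices k N"
proof -
  have e: "ends M \<subseteq> {1..Suc k}" and lt: "\<forall>(a, b)\<in>M. a < b"
    and dj: "\<And>e e'. e \<in> M \<Longrightarrow> e' \<in> M \<Longrightarrow> {fst e, snd e} \<inter> {fst e', snd e'} \<noteq> {} \<Longrightarrow> e = e'"
    using M by (auto simp: partial_matchings_def)
  obtain a b where ab: "(a, b) \<in> M" "a = Suc k \<or> b = Suc k"
    using s by (auto simp: ends_def)
  have "b \<le> Suc k" using ab(1) e ends_memI[of a b M] by auto
  then have aM: "(a, Suc k) \<in> M" and ak: "a < Suc k"
    using ab lt by auto
  define N where "N = M - {(a, Suc k)}"
  have MN: "M = insert (a, Suc k) N" "(a, Suc k) \<notin> N" using aM by (auto simp: N_def)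
  have nin: "Suc k \<notin> ends N" "a \<notin> ends N"
  proof -
    have "{x, y} \<inter> {a, Suc k} = {}" if "(x, y) \<in> N" for x y
      using dj[OF aM, of "(x, y)"] that MN by auto
    then show "Suc k \<notin> ends N" "a \<notin> ends N" by (auto simp: ends_def)
  qed
  have eN: "ends N \<subseteq> {1..k}"
    using e nin(1) unfolding MN(1) ends_insert by (auto simp: le_Suc_eq)
  have "a \<ge> 1" using e ends_memI(1)[OF aM] by auto
  then have ao: "a \<in> open_vertices k N" using nin(2) ak by (simp add: open_vertices_def)
  have "card (open_vertices k N) = Suc (card (open_vertices (Suc k) M))"
    unfolding MN(1) open_vertices_insert[OF eN ao]
    by (rule card.remove[OF finite_open_vertices ao])
  then have "N \<in> partial_matchings k (Suc h)"
    using M eN by (auto simp: partial_matchings_def MN(1))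
  then show thesis using that MN(1) ao by blast
qed

lemma partial_weight_Suc_open:
  assumes "M \<in> partial_matchings k h"
  shows "partial_weight x (Suc k) M = partial_weight x k M"
proof -
  have e: "ends M \<subseteq> {1..k}" using assms by (simp add: partial_matchings_def)
  have "nested_partial (Suc k) M e = nested_partial k M e" if "e \<in> M" for e
  proof -
    have "fst e \<in> ends M" using that by (intro ends_memI(1)[of _ "snd e"]) simp
    then have "\<not> Suc k < fst e" using e by auto
    then show ?thesis by (simp add: nested_partial_def open_vertices_Suc[OF e])
  qed
  then show ?thesis by (simp add: partial_weight_def)
qed

text \<open>An old edge keeps its status: if it was nested because of the open vertex
  \<open>a\<close>, it is now nested by the edge \<open>(a, Suc k)\<close>. The new edge reaches
  furthest right, so only an open vertex left of \<open>a\<close> can make it nested, and there is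
  none exactly if \<open>a\<close> is the leftmost one.\<close>

lemma partial_weight_Suc_insert:
  assumes M: "M \<in> partial_matchings k (Suc h)" and a: "a \<in> open_vertices k M"
  shows "partial_weight x (Suc k) (insert (a, Suc k) M) =
    (if a = Min (open_vertices k M) then x else 1) * partial_weight x k M"
proof -
  have e: "ends M \<subseteq> {1..k}" using M by (simp add: partial_matchings_def)
  let ?N = "insert (a, Suc k) M"
  have sk: "Suc k \<notin> ends M" using e by auto
  then have notin: "(a, Suc k) \<notin> M" by (auto simp: ends_def)
  have lt: "\<forall>(x, y)\<in>M. x < y" using M by (simp add: partial_matchings_def)
  have le: "snd e \<le> k" if "e \<in> M" for e
    using that e ends_memI(2)[of "fst e" "snd e" M] by auto
  have "nested_partial (Suc k) ?N e = nested_partial k M e" if "e \<in> M" for e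
    using le[OF that] a that lt
    by (auto simp: nested_partial_def open_vertices_insert[OF e a] nested_def split: prod.splits)
  moreover have "nested_partial (Suc k) ?N (a, Suc k) \<longleftrightarrow> a \<noteq> Min (open_vertices k M)"
  proof -
    have "nested_partial (Suc k) ?N (a, Suc k) \<longleftrightarrow> (\<exists>u\<in>open_vertices k M. u < a)"
      using le by (force simp: nested_partial_def open_vertices_insert[OF e a] nested_def)
    also have "\<dots> \<longleftrightarrow> a \<noteq> Min (open_vertices k M)"
      using a Min_in[of "open_vertices k M"] Min_le[OF finite_open_vertices a]
      by (metis Min_le finite_open_vertices empty_iff leD order_le_imp_less_or_eq)
    finally show ?thesis .
  qed
  ultimately show ?thesis
    using notin finite_partial_matching[OF M] by (simp add: partial_weight_def)
qed

lemma covered_Suc_open: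
  assumes "ends M \<subseteq> {1..k}" "v \<le> Suc k"
  shows "covered (Suc k) M v = covered k M v"
  using assms by (auto simp: covered_def open_vertices_Suc)

lemma covered_Suc_insert:
  assumes "ends M \<subseteq> {1..k}" "a \<in> open_vertices k M" "v \<le> k"
  shows "covered (Suc k) (insert (a, Suc k) M) v = covered k M v"
  using assms by (auto simp: covered_def open_vertices_insert)

lemma covered_Suc_self:
  assumes "ends M \<subseteq> {1..k}"
  shows "covered k M (Suc k) \<longleftrightarrow> open_vertices k M \<noteq> {}"
proof -
  have "b \<le> k" if "(a, b) \<in> M" for a b
    using assms ends_memI(2)[OF that] by auto
  moreover have "u < Suc k" if "u \<in> open_vertices k M" for u
    using that by (simp add: open_vertices_def)
  ultimately show ?thesis by (fastforce simp: covered_def)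
qed

section \<open>Transfer recursion for weighted partial matchings\<close>

definition matching_sum ::
    "'a::comm_semiring_1 \<Rightarrow> nat \<Rightarrow> nat \<Rightarrow> ((nat \<times> nat) set \<Rightarrow> bool) \<Rightarrow> 'a"
  where "matching_sum x k h P = (\<Sum>M | M \<in> partial_matchings k h \<and> P M. partial_weight x k M)"

lemma matching_sum_0: "matching_sum x 0 h P = (if h = 0 \<and> P {} then 1 else 0)"
proof -
  have "partial_matchings 0 h = (if h = 0 then {{}} else {})"
    by (auto simp: partial_matchings_def open_vertices_def ends_def)
  then have "{M. M \<in> partial_matchings 0 h \<and> P M} = (if h = 0 \<and> P {} then {{}} else {})"
    by auto
  then show ?thesis by (simp add: matching_sum_def partial_weight_def)
qed

lemma insert_last_edge_inj:
  assumes "Suc k \<notin> ends M" "Suc k \<notin> ends N" "insert (a, Suc k) M = insert (b, Suc k) N"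
  shows "M = N \<and> a = b"
proof -
  have "{e \<in> insert (a, Suc k) M. snd e \<noteq> Suc k} = M" "{e \<in> insert (b, Suc k) N. snd e \<noteq> Suc k} = N"
    using assms(1,2) by (auto dest: ends_memI)
  then have "M = N" using assms(3) by simp
  moreover have "(a, Suc k) \<in> insert (b, Suc k) N" "(a, Suc k) \<notin> N"
    using assms by (auto dest: ends_memI)
  ultimately show ?thesis by simp
qed

text \<open>The new vertex either stays open or closes one of \<open>h + 1\<close> open vertices;
  the leftmost choice gives \<open>x\<close> and the other \<open>h\<close> give 1. \<open>Q\<close>
  is what \<open>P\<close> says about the matching before its last edge is added, so that side
  conditions such as connectedness can be carried along.\<close>

lemma matching_sum_Suc:
  assumes PQ: "\<And>M a. M \<in> partial_matchings k (Suc h) \<Longrightarrow> a \<in> open_vertices k M \<Longrightarrow>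
    P (insert (a, Suc k) M) \<longleftrightarrow> Q M"
  shows "matching_sum x (Suc k) h P =
    (case h of 0 \<Rightarrow> 0 | Suc h' \<Rightarrow> matching_sum x k h' P) + (of_nat h + x) * matching_sum x k (Suc h) Q"
proof -
  let ?A = "case h of 0 \<Rightarrow> {} | Suc h' \<Rightarrow> {M. M \<in> partial_matchings k h' \<and> P M}"
  let ?Q = "{M. M \<in> partial_matchings k (Suc h) \<and> Q M}"
  let ?S = "Sigma ?Q (open_vertices k)"
  let ?f = "\<lambda>(M, a). insert (a, Suc k) M"
  have e: "ends M \<subseteq> {1..k}" if "M \<in> partial_matchings k j" for M j
    using that by (simp add: partial_matchings_def)
  have sk: "Suc k \<notin> ends M" if "M \<in> partial_matchings k j" for M j
    using e[OF that] by auto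
  have split: "{M. M \<in> partial_matchings (Suc k) h \<and> P M} = ?A \<union> ?f ` ?S"
  proof (intro set_eqI iffI)
    fix M assume M: "M \<in> {M. M \<in> partial_matchings (Suc k) h \<and> P M}"
    show "M \<in> ?A \<union> ?f ` ?S"
    proof (cases "Suc k \<in> ends M")
      case True
      then obtain a N where N: "M = insert (a, Suc k) N" "N \<in> partial_matchings k (Suc h)"
        "a \<in> open_vertices k N"
        using M partial_matchings_Suc_remove by blast
      then have "Q N" using M PQ by blast
      then show ?thesis using N by (intro UnI2 image_eqI[of _ _ "(N, a)"]) auto
    next
      case False
      have "ends M \<subseteq> {1..Suc k}" using M by (simp add: partial_matchings_def)
      then have "ends M \<subseteq> {1..k}" using False by (auto simp: le_Suc_eq)
      from partial_matchings_Suc_open[OF this] M show ?thesis by auto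
    qed
  next
    fix M assume "M \<in> ?A \<union> ?f ` ?S"
    then show "M \<in> {M. M \<in> partial_matchings (Suc k) h \<and> P M}"
    proof
      assume "M \<in> ?A"
      then obtain h' where "h = Suc h'" "M \<in> partial_matchings k h'" "P M"
        by (auto split: nat.splits)
      then show ?thesis using partial_matchings_Suc_open[OF e] by blast
    next
      assume "M \<in> ?f ` ?S"
      then show ?thesis using PQ by (auto intro: partial_matchings_Suc_insert)
    qed
  qed
  have finA: "finite ?A" by (simp add: finite_partial_matchings split: nat.split)
  have finQ: "finite ?Q" by (simp add: finite_partial_matchings)
  have disj: "?A \<inter> ?f ` ?S = {}"
  proof -
    have "Suc k \<notin> ends M" if "M \<in> ?A" for M using that sk by (auto split: nat.splits)
    moreover have "Suc k \<in> ends M" if "M \<in> ?f ` ?S" for M using that by (auto simp: ends_insert)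
    ultimately show ?thesis by blast
  qed
  have inj: "inj_on ?f ?S"
  proof (rule inj_onI, clarsimp)
    fix M a N b
    assume "M \<in> partial_matchings k (Suc h)" "N \<in> partial_matchings k (Suc h)"
      "insert (a, Suc k) M = insert (b, Suc k) N"
    then show "M = N \<and> a = b" using insert_last_edge_inj[OF sk sk] by blast
  qed
  have A: "(\<Sum>M\<in>?A. partial_weight x (Suc k) M) =
      (case h of 0 \<Rightarrow> 0 | Suc h' \<Rightarrow> matching_sum x k h' P)"
    by (auto simp: matching_sum_def partial_weight_Suc_open split: nat.split intro!: sum.cong)
  have closer: "(\<Sum>a\<in>open_vertices k M. if a = Min (open_vertices k M) then x else 1) = of_nat h + x"
    if "M \<in> ?Q" for M
  proof -
    let ?O = "open_vertices k M"
    have card: "card ?O = Suc h" using that by (simp add: partial_matchings_def)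
    then have "Min ?O \<in> ?O" by (intro Min_in) auto
    then have "(\<Sum>a\<in>?O. if a = Min ?O then x else 1) = x + (\<Sum>a\<in>?O - {Min ?O}. if a = Min ?O then x else 1)"
      by (subst sum.remove) auto
    also have "(\<Sum>a\<in>?O - {Min ?O}. if a = Min ?O then x else 1) = (\<Sum>a\<in>?O - {Min ?O}. 1)"
      by (rule sum.cong) auto
    also have "\<dots> = of_nat h" using card \<open>Min ?O \<in> ?O\<close> by simp
    finally show ?thesis by (simp add: add.commute)
  qed
  have "(\<Sum>M\<in>?f ` ?S. partial_weight x (Suc k) M) =
      (\<Sum>(M, a)\<in>?S. (if a = Min (open_vertices k M) then x else 1) * partial_weight x k M)"
    unfolding sum.reindex[OF inj]
    by (rule sum.cong) (auto simp: partial_weight_Suc_insert)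
  also have "\<dots> = (\<Sum>M\<in>?Q. \<Sum>a\<in>open_vertices k M.
      (if a = Min (open_vertices k M) then x else 1) * partial_weight x k M)"
    using finQ by (subst sum.Sigma) simp_all
  also have "\<dots> = (\<Sum>M\<in>?Q. (of_nat h + x) * partial_weight x k M)"
    by (rule sum.cong) (simp_all only: closer flip: sum_distrib_right)
  finally have B: "(\<Sum>M\<in>?f ` ?S. partial_weight x (Suc k) M) = (of_nat h + x) * matching_sum x k (Suc h) Q"
    by (simp add: matching_sum_def sum_distrib_left)
  show ?thesis
    unfolding matching_sum_def[of x "Suc k" h P] split A[symmetric] B[symmetric]
    by (rule sum.union_disjoint) (use finA finQ disj in auto)
qed

lemma matching_sum_True: "matching_sum x k h (\<lambda>_. True) = path_sum x k h"
proof (induction k arbitrary: h)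
  case 0
  then show ?case by (simp add: matching_sum_0)
next
  case (Suc k)
  then show ?case by (subst matching_sum_Suc[where Q = "\<lambda>_. True"]) (simp_all split: nat.split)
qed

text \<open>Coverage of the vertices from 2 on keeps at least one vertex open after the first, so
  dropping the first opener and lowering all heights by 1 leaves an arbitrary nonnegative path. A
  closer has weight \<open>Suc h + x\<close>, which is \<open>h + (x + 1)\<close>.\<close>

lemma matching_sum_covered:
  "matching_sum x (Suc k) (Suc h) (\<lambda>M. \<forall>v\<in>{2..Suc k}. covered (Suc k) M v) = path_sum (x + 1) k h"
proof (induction k arbitrary: h)
  case 0
  have "matching_sum x (Suc 0) (Suc h) (\<lambda>M. \<forall>v\<in>{2..Suc 0}. covered (Suc 0) M v) = matching_sum x 0 h (\<lambda>_. True)"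
    by (subst matching_sum_Suc[where Q = "\<lambda>_. True"]) (simp_all add: matching_sum_0)
  then show ?case by (simp add: matching_sum_0)
next
  case (Suc k)
  let ?P = "\<lambda>j M. \<forall>v\<in>{2..j}. covered j M v"
  have e: "ends M \<subseteq> {1..j}" if "M \<in> partial_matchings j i" for M i j
    using that by (simp add: partial_matchings_def)
  have "matching_sum x (Suc (Suc k)) (Suc h) (?P (Suc (Suc k))) =
     matching_sum x (Suc k) h (?P (Suc (Suc k)))
     + (of_nat (Suc h) + x) * matching_sum x (Suc k) (Suc (Suc h)) (?P (Suc k))"
  proof (subst matching_sum_Suc[where Q = "?P (Suc k)"])
    fix M a assume M: "M \<in> partial_matchings (Suc k) (Suc (Suc h))" and a: "a \<in> open_vertices (Suc k) M"
    let ?N = "insert (a, Suc (Suc k)) M"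
    \<comment> \<open>Closing \<open>a\<close> leaves another vertex open, and this one covers the
      new vertex.\<close>
    have "open_vertices (Suc k) M - {a} \<noteq> {}"
    proof
      assume "open_vertices (Suc k) M - {a} = {}"
      then have "card (open_vertices (Suc k) M) \<le> card {a}" by (intro card_mono) auto
      then show False using M by (simp add: partial_matchings_def)
    qed
    then obtain u where u: "u \<in> open_vertices (Suc k) M - {a}" by blast
    then have "u < Suc (Suc k)" by (simp add: open_vertices_def)
    moreover have "u \<in> open_vertices (Suc (Suc k)) ?N"
      using u unfolding open_vertices_insert[OF e[OF M] a] .
    ultimately have "covered (Suc (Suc k)) ?N (Suc (Suc k))" unfolding covered_def by blast
    moreover have "{2..Suc (Suc k)} = insert (Suc (Suc k)) {2..Suc k}" by auto
    ultimately show "?P (Suc (Suc k)) ?N \<longleftrightarrow> ?P (Suc k) M"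
      by (simp add: covered_Suc_insert[OF e[OF M] a])
  qed simp
  \<comment> \<open>An opener is covered exactly if some vertex was open before it, so
    \<open>h = 0\<close> contributes nothing.\<close>
  also have "matching_sum x (Suc k) h (?P (Suc (Suc k))) =
      (case h of 0 \<Rightarrow> 0 | Suc h' \<Rightarrow> matching_sum x (Suc k) h (?P (Suc k)))"
  proof -
    have "?P (Suc (Suc k)) M \<longleftrightarrow> h \<noteq> 0 \<and> ?P (Suc k) M" if M: "M \<in> partial_matchings (Suc k) h" for M
    proof -
      have "open_vertices (Suc k) M \<noteq> {} \<longleftrightarrow> h \<noteq> 0"
        using M by (auto simp: partial_matchings_def card_eq_0_iff)
      moreover have "{2..Suc (Suc k)} = insert (Suc (Suc k)) {2..Suc k}" by auto
      ultimately show ?thesis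
        using covered_Suc_self[OF e[OF M]] by (simp add: covered_Suc_open[OF e[OF M]])
    qed
    then have "{M. M \<in> partial_matchings (Suc k) h \<and> ?P (Suc (Suc k)) M} =
      {M. M \<in> partial_matchings (Suc k) h \<and> h \<noteq> 0 \<and> ?P (Suc k) M}"
      by blast
    then show ?thesis unfolding matching_sum_def by (simp split: nat.split)
  qed
  finally show ?case by (simp add: Suc.IH algebra_simps split: nat.split)
qed

section \<open>Complete and connected matchings\<close>

lemma matchings_eq: "matchings m = partial_matchings (2 * m) 0"
proof (intro set_eqI iffI)
  let ?f = "\<lambda>(a::nat, b). {a, b}"
  fix M assume M: "M \<in> matchings m"
  then have lt: "\<forall>(a, b)\<in>M. a < b" and part: "partition_on {1..2 * m} (?f ` M)"
    by (auto simp: matchings_def)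
  have "ends M = {1..2 * m}"
    using partition_onD1[OF part] by (simp add: ends_def)
  moreover have "e = e'" if "e \<in> M" "e' \<in> M" "{fst e, snd e} \<inter> {fst e', snd e'} \<noteq> {}" for e e'
  proof -
    have meet: "?f e \<inter> ?f e' \<noteq> {}" using that(3) unfolding case_prod_beta .
    have "?f e = ?f e'"
    proof (rule ccontr)
      assume "?f e \<noteq> ?f e'"
      from disjointD[OF partition_onD2[OF part] imageI[OF that(1)] imageI[OF that(2)] this]
      show False using meet by contradiction
    qed
    moreover have "fst e < snd e" "fst e' < snd e'" using lt that(1,2) by auto
    ultimately show ?thesis
      by (cases e; cases e') (auto simp: doubleton_eq_iff)
  qed
  ultimately show "M \<in> partial_matchings (2 * m) 0"
    using lt by (auto simp: partial_matchings_def open_vertices_def)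
next
  let ?f = "\<lambda>(a::nat, b). {a, b}"
  fix M assume M: "M \<in> partial_matchings (2 * m) 0"
  then have "open_vertices (2 * m) M = {}"
    by (simp add: partial_matchings_def)
  then have "\<Union> (?f ` M) = {1..2 * m}"
    using M by (auto simp: partial_matchings_def open_vertices_def ends_def)
  moreover have "disjoint (?f ` M)"
  proof (rule disjointI)
    fix X Y assume "X \<in> ?f ` M" "Y \<in> ?f ` M" "X \<noteq> Y"
    then obtain e e' where *: "e \<in> M" "e' \<in> M" "X = {fst e, snd e}" "Y = {fst e', snd e'}"
      unfolding case_prod_beta by (elim imageE)
    then have "e \<noteq> e'" using \<open>X \<noteq> Y\<close> by blast
    with * show "X \<inter> Y = {}" using M unfolding partial_matchings_def by blast
  qed
  ultimately show "M \<in> matchings m"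
    using M by (auto simp: matchings_def partition_on_def partial_matchings_def)
qed

lemma open_vertices_complete: "M \<in> partial_matchings k 0 \<Longrightarrow> open_vertices k M = {}"
  by (simp add: partial_matchings_def)

lemma partial_weight_complete:
  "M \<in> partial_matchings k 0 \<Longrightarrow> partial_weight x k M = (\<Prod>e\<in>M. if nested M e then 1 else x)"
  by (simp add: partial_weight_def nested_partial_def open_vertices_complete)

lemma matching_gf_eq: "matching_gf n = path_sum (cvar + 1) (2 * n) 0"
proof -
  have "matching_gf n = matching_sum (cvar + 1) (2 * n) 0 (\<lambda>_. True)"
    unfolding matching_gf_def matching_sum_def matchings_eq
    by (rule sum.cong) (auto simp: partial_weight_complete add.commute intro!: prod.cong)
  then show ?thesis by (simp only: matching_sum_True)
qed

text \<open>Two factors \<open>cvar\<close> cancel: one is supplied on the left so that the edge at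
  vertex 1 is weighted like every other non-nested edge, the other appears on the right because the
  last vertex closes the only open vertex.\<close>

lemma connected_matching_gf_eq: "connected_matching_gf (n + 1) = path_sum (cvar + 1) (2 * n) 0"
proof -
  let ?k = "Suc (2 * n)"
  let ?P = "\<lambda>M. \<forall>v\<in>{2..?k}. covered (Suc ?k) M v"
  have conn: "connected_matchings (n + 1) = {M. M \<in> partial_matchings (Suc ?k) 0 \<and> ?P M}"
  proof -
    have "{1..2 * (n + 1)} - {1, 2 * (n + 1)} = {2..?k}" by auto
    then show ?thesis
      unfolding connected_matchings_def matchings_eq
      by (auto simp: covered_def open_vertices_complete)
  qed
  have weight: "cvar * (\<Prod>e\<in>M. if \<not> nested M e \<and> fst e \<noteq> 1 \<and> snd e \<noteq> 1 then cvar else 1)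
      = partial_weight cvar (Suc ?k) M" if M: "M \<in> partial_matchings (Suc ?k) 0" for M
  proof -
    have "1 \<in> ends M" and lt: "\<forall>(a, b)\<in>M. a < b" and e: "ends M \<subseteq> {1..Suc ?k}"
      using M open_vertices_complete[OF M] by (auto simp: partial_matchings_def open_vertices_def)
    have pos: "1 \<le> a" if "(a, b) \<in> M" for a b using ends_memI(1)[OF that] e by auto
    obtain b where b: "(1, b) \<in> M"
      using \<open>1 \<in> ends M\<close> lt pos unfolding ends_def by fastforce
    have uniq: "e = (1, b)" if "e \<in> M" "fst e = 1 \<or> snd e = 1" for e
      using that b M unfolding partial_matchings_def by fastforce
    have non: "\<not> nested M (1, b)" using pos by (fastforce simp: nested_def)
    have fin: "finite M" by (rule finite_partial_matching[OF M])
    let ?F = "\<lambda>e. if \<not> nested M e \<and> fst e \<noteq> 1 \<and> snd e \<noteq> 1 then cvar else 1"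
    have "prod ?F M = ?F (1, b) * prod ?F (M - {(1, b)})"
      by (rule prod.remove[OF fin b])
    also have "prod ?F (M - {(1, b)}) = (\<Prod>e\<in>M - {(1, b)}. if nested M e then 1 else cvar)"
    proof (rule prod.cong)
      fix e assume "e \<in> M - {(1, b)}"
      then have "fst e \<noteq> 1 \<and> snd e \<noteq> 1" using uniq by blast
      then show "?F e = (if nested M e then 1 else cvar)" by simp
    qed simp
    also have "?F (1, b) * \<dots> = \<dots>" by simp
    finally have "prod ?F M = (\<Prod>e\<in>M - {(1, b)}. if nested M e then 1 else cvar)" .
    moreover have "(\<Prod>e\<in>M. if nested M e then 1 else cvar) =
        cvar * (\<Prod>e\<in>M - {(1, b)}. if nested M e then 1 else cvar)"
      by (subst prod.remove[OF fin b]) (use non in simp)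
    ultimately show ?thesis by (simp only: partial_weight_complete[OF M])
  qed
  have "cvar * connected_matching_gf (n + 1) = matching_sum cvar (Suc ?k) 0 ?P"
    unfolding connected_matching_gf_def conn matching_sum_def sum_distrib_left
    by (rule sum.cong) (simp_all only: weight mem_Collect_eq)
  also have "\<dots> = cvar * matching_sum cvar ?k (Suc 0) (\<lambda>M. \<forall>v\<in>{2..?k}. covered ?k M v)"
  proof (subst matching_sum_Suc)
    fix M a assume M: "M \<in> partial_matchings ?k (Suc 0)" and a: "a \<in> open_vertices ?k M"
    then have "ends M \<subseteq> {1..?k}" by (simp add: partial_matchings_def)
    from covered_Suc_insert[OF this a]
    show "?P (insert (a, Suc ?k) M) \<longleftrightarrow> (\<forall>v\<in>{2..?k}. covered ?k M v)" by simp
  qed simp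
  also have "\<dots> = cvar * path_sum (cvar + 1) (2 * n) 0"
    by (simp only: matching_sum_covered)
  finally show ?thesis by simp
qed

subsection \<open>A continued fraction for pairs of permutations and involutions\<close>

text \<open>As \<open>card_involutions\<close> shows, this counts the fixed point free involutions
  of \<open>n\<close> points: the double factorial \<open>(n - 1)!!\<close> for even
  \<open>n\<close> and 0 for odd \<open>n\<close>.\<close>

fun involution_count :: "nat \<Rightarrow> nat" where
  "involution_count 0 = 1"
| "involution_count (Suc 0) = 0"
| "involution_count (Suc (Suc n)) = Suc n * involution_count n"

text \<open>The number of pairs of a permutation and a fixed point free involution of \<open>n\<close> points,
  with weight \<open>c\<close> per cycle of the permutation, divided by \<open>n!\<close>.\<close>

definition pair_density :: "'a::field_char_0 \<Rightarrow> nat \<Rightarrow> 'a"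
  where "pair_density c n = of_nat (involution_count n) * pochhammer c n / fact n"

lemma pair_density_0 [simp]: "pair_density c 0 = 1" and pair_density_1 [simp]: "pair_density c (Suc 0) = 0"
  by (simp_all add: pair_density_def)

text \<open>A contiguity relation of the hypergeometric series 2F0(c/2, (c+1)/2; 2 z^2). With p =
  (c+1)(c+2)...(c+n+1), all terms share the factor \<open>involution_count n * p / fact n\<close>,
  and what remains is c/(n+2) + 1 = (c+n+2)/(n+2).\<close>

lemma pair_density_Suc_Suc:
  "pair_density c (Suc (Suc n)) + (c + 1) * pair_density (c + 2) n = pair_density (c + 1) (Suc (Suc n))"
proof -
  have A: "pair_density x (Suc (Suc n)) =
      of_nat (involution_count n) * pochhammer x (Suc (Suc n)) / (of_nat (Suc (Suc n)) * fact n)" for x :: 'a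
  proof -
    have "(of_nat (Suc n) :: 'a) \<noteq> 0" using of_nat_neq_0 by blast
    then show ?thesis
      unfolding pair_density_def involution_count.simps fact_Suc of_nat_mult by simp
  qed
  have nz: "(of_nat (Suc (Suc n)) :: 'a) \<noteq> 0" using of_nat_neq_0 by blast
  let ?p = "pochhammer (c + 1) (Suc n)"
  have p: "(c + 1) * pochhammer (c + 2) n = ?p"
    by (simp add: pochhammer_rec add.assoc)
  have "pochhammer c (Suc (Suc n)) = c * ?p"
    by (simp add: pochhammer_rec)
  moreover have "pochhammer (c + 1) (Suc (Suc n)) = ?p * (c + 1 + of_nat (Suc n))"
    by (rule pochhammer_Suc)
  moreover have "(c + 1) * pair_density (c + 2) n = of_nat (involution_count n) * ?p / fact n"
    by (simp add: pair_density_def flip: p)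
  moreover have "c + 1 + of_nat (Suc n) = c + (of_nat (Suc (Suc n)) :: 'a)"
    by simp
  moreover have "i * (c * p) / (k * f) + i * p / f = i * (p * (c + k)) / (k * f)"
    if "k \<noteq> 0" "f \<noteq> 0" for i p f k :: 'a
    using that by (simp add: field_simps)
  ultimately show ?thesis
    unfolding A using nz by (simp only: fact_nonzero not_False_eq_True)
qed

text \<open>Writing \<open>G c\<close> for the series with coefficients \<open>pair_density c\<close>, the preceding
  three-term relation is \<open>G c + (c + 1) * z^2 * G (c + 2) = G (c + 1)\<close>. It shows that the series of
  paths ending at height \<open>h\<close> is \<open>z^h * G (c + h + 1) / G c\<close>.\<close>

lemma pair_density_convolution:
  "(\<Sum>k\<le>n. path_sum (c + 1) k h * pair_density c (n - k)) =
    (if h \<le> n then pair_density (c + of_nat h + 1) (n - h) else 0)"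
proof (induction n arbitrary: h)
  case 0
  then show ?case by simp
next
  case (Suc n)
  let ?F = "\<lambda>n h. \<Sum>k\<le>n. path_sum (c + 1) k h * pair_density c (n - k)"
  have "?F (Suc n) h = (if h = 0 then pair_density c (Suc n) else 0) +
      (\<Sum>k\<le>n. path_sum (c + 1) (Suc k) h * pair_density c (n - k))"
    by (subst sum.atMost_Suc_shift) simp
  also have "(\<Sum>k\<le>n. path_sum (c + 1) (Suc k) h * pair_density c (n - k)) =
      (case h of 0 \<Rightarrow> 0 | Suc h' \<Rightarrow> ?F n h') + (of_nat h + (c + 1)) * ?F n (Suc h)"
    by (simp add: algebra_simps sum.distrib sum_distrib_left split: nat.split)
  finally have rec: "?F (Suc n) h = (if h = 0 then pair_density c (Suc n) else 0) +
      (case h of 0 \<Rightarrow> 0 | Suc h' \<Rightarrow> ?F n h') + (of_nat h + (c + 1)) * ?F n (Suc h)"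
    by (simp only: add.assoc)
  \<comment> \<open>At the end of the range the second term falls away; what remains is a density at
    0 or 1, which does not depend on \<open>d\<close>.\<close>
  have three_term: "pair_density d (Suc m - i) + (d + 1) * (if Suc i \<le> m then pair_density (d + 2) (m - Suc i) else 0)
      = pair_density (d + 1) (Suc m - i)" if "i \<le> Suc m" for d :: 'a and m i
  proof -
    consider "i = Suc m" | "i = m" | j where "m = i + Suc j"
      using \<open>i \<le> Suc m\<close> by (metis less_imp_Suc_add add_Suc_right le_SucE nat_less_le)
    then show ?thesis
    proof cases
      case 3
      then have "Suc m - i = Suc (Suc j)" "m - Suc i = j" "Suc i \<le> m" by simp_all
      then show ?thesis using pair_density_Suc_Suc[of d j] by simp
    qed simp_all
  qed
  \<comment> \<open>The first term of the relation comes from the isolated summand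
    \<open>k = 0\<close> if \<open>h = 0\<close>, with parameter \<open>c\<close>, and from the
    paths arriving from height \<open>h - 1\<close> otherwise, with parameter
    \<open>c + h\<close>.\<close>
  show ?case
  proof (cases h)
    case 0
    then show ?thesis unfolding rec Suc.IH using three_term[of 0 n c] by (auto simp: algebra_simps)
  next
    case h: (Suc h')
    show ?thesis
    proof (cases "h \<le> Suc n")
      case True
      then show ?thesis
        unfolding rec Suc.IH using three_term[of h n "c + of_nat h"] by (auto simp: h algebra_simps)
    next
      case False
      then show ?thesis unfolding rec Suc.IH by (simp add: h)
    qed
  qed
qed

text \<open>This counts pairs on \<open>n + 1\<close> darts by the component of a chosen dart, with
  \<open>j\<close> further darts in it, once \<open>c * fact j * path_sum (c + 1) (Suc j) 0\<close>
  is taken for the connected pairs. Writing the binomials as factorials leaves a convolution of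
  \<open>path_sum\<close> with \<open>pair_density\<close>.\<close>

lemma pair_count_recurrence:
  fixes c :: "'a::field_char_0"
  shows "(\<Sum>j\<le>n. of_nat (n choose j) * (c * fact j * path_sum (c + 1) (Suc j) 0) *
      (of_nat (involution_count (n - j)) * pochhammer c (n - j)))
    = of_nat (involution_count (Suc n)) * pochhammer c (Suc n)"
proof -
  let ?P = "\<lambda>k. path_sum (c + 1) k 0"
  have "(\<Sum>j\<le>n. of_nat (n choose j) * (c * fact j * ?P (Suc j)) *
      (of_nat (involution_count (n - j)) * pochhammer c (n - j)))
    = (\<Sum>j\<le>n. c * fact n * (?P (Suc j) * pair_density c (n - j)))"
  proof (rule sum.cong)
    fix j assume "j \<in> {..n}"
    then have "(fact j * fact (n - j) * of_nat (n choose j) :: 'a) = fact n"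
      using binomial_fact_lemma[of j n] by (metis atMost_iff of_nat_fact of_nat_mult)
    then show "of_nat (n choose j) * (c * fact j * ?P (Suc j)) *
      (of_nat (involution_count (n - j)) * pochhammer c (n - j))
      = c * fact n * (?P (Suc j) * pair_density c (n - j))"
      unfolding pair_density_def
      by (simp add: field_simps del: path_sum.simps flip: \<open>_ = fact n\<close>)
  qed simp
  also have "\<dots> = c * fact n * (\<Sum>j\<le>n. ?P (Suc j) * pair_density c (n - j))"
    by (simp only: sum_distrib_left)
  also have "(\<Sum>j\<le>n. ?P (Suc j) * pair_density c (n - j)) = pair_density (c + 1) (Suc n) - pair_density c (Suc n)"
    using pair_density_convolution[where n = "Suc n" and h = 0 and c = c]
    by (subst (asm) sum.atMost_Suc_shift) (simp add: algebra_simps del: path_sum.simps(2))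
  also have "c * fact n * \<dots> = fact n * (c * pair_density (c + 1) (Suc n) - c * pair_density c (Suc n))"
    by (simp add: algebra_simps)
  also have "c * pair_density (c + 1) (Suc n) = (c + of_nat (Suc n)) * pair_density c (Suc n)"
  proof -
    have "c * pochhammer (c + 1) (Suc n) = (c + of_nat (Suc n)) * pochhammer c (Suc n)"
      by (metis pochhammer_rec pochhammer_Suc mult.commute)
    then show ?thesis unfolding pair_density_def times_divide_eq_right by (metis mult.left_commute)
  qed
  also have "fact n * ((c + of_nat (Suc n)) * pair_density c (Suc n) - c * pair_density c (Suc n))
    = fact (Suc n) * pair_density c (Suc n)"
    by (simp add: algebra_simps)
  also have "\<dots> = of_nat (involution_count (Suc n)) * pochhammer c (Suc n)"
    unfolding pair_density_def by (simp del: fact_Suc)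
  finally show ?thesis .
qed

subsection \<open>Cycles of permutations\<close>

definition cycle_count :: "('a \<Rightarrow> 'a) \<Rightarrow> 'a set \<Rightarrow> nat"
  where "cycle_count p X = card (orbit p ` X)"

lemma orbit_absorb:
  assumes "permutation p" "y \<in> orbit p x"
  shows "orbit p y = orbit p x"
  using assms cyclic_on_orbit'[OF assms(1), of x] orbit_cyclic_eq3 by fastforce

lemma cycle_count_insert_fixpoint:
  assumes "finite S" "a \<notin> S" "q permutes S"
  shows "cycle_count q (insert a S) = Suc (cycle_count q S)"
proof -
  have "q a = a" using assms by (simp add: permutes_not_in)
  then have "orbit q a = {a}" by (simp add: orbit_eq_singleton_iff)
  moreover have "{a} \<notin> orbit q ` S"
    using permutes_orbit_subset[OF assms(3)] assms(2) by blast
  ultimately show ?thesis using assms(1) by (simp add: cycle_count_def)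
qed

text \<open>Composing with the transposition inserts \<open>a\<close> into the cycle of
  \<open>b\<close>, directly before \<open>b\<close>: the preimage of \<open>b\<close> now goes to
  \<open>a\<close>, and \<open>a\<close> to \<open>b\<close>. Intersecting with \<open>S\<close>
  recovers the old cycles.\<close>

lemma cycle_count_insert_transpose:
  assumes fin: "finite S" and a: "a \<notin> S" and q: "q permutes S" and b: "b \<in> S"
  shows "cycle_count (transpose a b \<circ> q) (insert a S) = cycle_count q S"
proof -
  let ?p = "transpose a b \<circ> q"
  have "?p permutes insert a S"
    using b q by (intro permutes_compose permutes_swap_id permutes_imp_permutes_insert) auto
  then have perm: "permutation ?p" using fin by (auto simp: permutation_permutes)
  have perm_q: "permutation q" using q fin by (auto simp: permutation_permutes)
  have pa: "?p a = b" using q a by (simp add: permutes_not_in)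
  have pq: "?p x = (if q x = b then a else q x)" if "x \<in> S" for x
    using permutes_in_image[OF q, of x] that a by (auto simp: transpose_def)
  have sub: "orbit q x \<subseteq> S" if "x \<in> S" for x
    by (rule permutes_orbit_subset[OF q that])
  have 1: "orbit q x \<subseteq> orbit ?p x" if x: "x \<in> S" for x
  proof
    \<comment> \<open>One step of \<open>q\<close> is one step of \<open>?p\<close>, or two if it
      passes through \<open>a\<close>.\<close>
    have advance: "q y \<in> orbit ?p x" if "y \<in> S" "?p y \<in> orbit ?p x" for y
      using orbit.step[OF that(2)] that pq[OF that(1)] pa by (auto split: if_splits)
    fix y assume "y \<in> orbit q x"
    then show "y \<in> orbit ?p x"
    proof induction
      case base
      show ?case by (rule advance[OF x orbit.base])
    next
      case (step y)
      then show ?case using advance[OF _ orbit.step[OF step.IH]] sub[OF x] by blast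
    qed
  qed
  have 2: "orbit ?p x \<inter> S \<subseteq> orbit q x" if x: "x \<in> S" for x
  proof -
    \<comment> \<open>The second conjunct carries the induction past \<open>a\<close>, which is
      outside \<open>S\<close>: the next point is \<open>b\<close>.\<close>
    have "(y \<in> S \<longrightarrow> y \<in> orbit q x) \<and> (y = a \<longrightarrow> b \<in> orbit q x)" if "y \<in> orbit ?p x" for y
      using that
    proof induction
      case base
      show ?case using pq[OF x] orbit.base[of q x] a by (auto split: if_splits)
    next
      case (step y)
      have "y \<in> insert a S"
        using step.hyps permutes_orbit_subset[OF \<open>?p permutes insert a S\<close>, of x] x by auto
      then show ?case
      proof
        assume "y = a"
        then show ?thesis using step.IH pa a b by (auto simp del: o_apply)
      next
        assume "y \<in> S"
        moreover from this have "q y \<in> S" using permutes_in_image[OF q] by simp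
        ultimately show ?thesis using step.IH pq[of y] orbit.step[of y q x] a by (auto simp del: o_apply)
      qed
    qed
    then show ?thesis by blast
  qed
  have inter: "orbit ?p x \<inter> S = orbit q x" if "x \<in> S" for x
    using 1[OF that] 2[OF that] sub[OF that] by blast
  have "orbit ?p a = orbit ?p b"
    using permutation_orbit_step[OF perm, of a] pa by simp
  then have "orbit ?p ` insert a S = orbit ?p ` S" using b by auto
  moreover have "inj_on (\<lambda>Y. Y \<inter> S) (orbit ?p ` S)"
  proof (rule inj_onI)
    fix Y Z assume "Y \<in> orbit ?p ` S" "Z \<in> orbit ?p ` S" and eq: "Y \<inter> S = Z \<inter> S"
    then obtain x z where xz: "x \<in> S" "z \<in> S" "Y = orbit ?p x" "Z = orbit ?p z" by blast
    have "x \<in> orbit ?p z"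
      using permutation_self_in_orbit[OF perm, of x] eq xz by blast
    then show "Y = Z" using orbit_absorb[OF perm] xz by blast
  qed
  moreover have "(\<lambda>Y. Y \<inter> S) ` orbit ?p ` S = orbit q ` S"
    unfolding image_image by (rule image_cong) (simp_all only: inter)
  ultimately show ?thesis
    unfolding cycle_count_def by (metis card_image)
qed

text \<open>Each new point either forms a cycle of its own, giving a factor \<open>c\<close>, or is
  inserted before one of the old points without changing the number of cycles.\<close>

lemma sum_cycle_count:
  assumes "finite X"
  shows "(\<Sum>p | p permutes X. c ^ cycle_count p X) = pochhammer (c :: 'a::comm_semiring_1) (card X)"
  using assms
proof induction
  case empty
  then show ?case by (simp add: cycle_count_def)
next
  case (insert a S)
  have "(\<Sum>p | p permutes insert a S. c ^ cycle_count p (insert a S)) =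
    (\<Sum>b\<in>insert a S. \<Sum>q | q permutes S. c ^ cycle_count (transpose a b \<circ> q) (insert a S))"
    by (rule sum_over_permutations_insert[OF insert.hyps])
  also have "\<dots> = (\<Sum>q | q permutes S. c ^ cycle_count q (insert a S)) +
    (\<Sum>b\<in>S. \<Sum>q | q permutes S. c ^ cycle_count (transpose a b \<circ> q) (insert a S))"
    using insert.hyps by simp
  also have "\<dots> = (\<Sum>q | q permutes S. c * c ^ cycle_count q S) +
    (\<Sum>b\<in>S. \<Sum>q | q permutes S. c ^ cycle_count q S)"
    using insert.hyps
    by (simp add: cycle_count_insert_fixpoint cycle_count_insert_transpose)
  also have "\<dots> = (c + of_nat (card S)) * pochhammer c (card S)"
    by (simp add: insert.IH algebra_simps flip: sum_distrib_left)
  finally show ?case using insert.hyps by (simp add: pochhammer_Suc mult.commute)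
qed

text \<open>Permutations of a set are the identity outside it, so composing permutations of disjoint
  sets forms their disjoint union.\<close>

lemma permutes_union:
  assumes p: "p permutes S" and q: "q permutes T" and disj: "S \<inter> T = {}"
  shows "p \<circ> q permutes S \<union> T" "x \<in> S \<Longrightarrow> (p \<circ> q) x = p x" "x \<in> T \<Longrightarrow> (p \<circ> q) x = q x"
proof -
  show "p \<circ> q permutes S \<union> T"
    by (intro permutes_compose permutes_subset[OF p] permutes_subset[OF q]) auto
  show "x \<in> S \<Longrightarrow> (p \<circ> q) x = p x"
    using permutes_not_in[OF q, of x] disj by (auto simp: disjoint_iff)
  show "x \<in> T \<Longrightarrow> (p \<circ> q) x = q x"
    using permutes_in_image[OF q, of x] permutes_not_in[OF p, of "q x"] disj by (auto simp: disjoint_iff)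
qed

lemma permutes_union_eq:
  assumes "p permutes S" "q permutes T" "p' permutes S" "q' permutes T" "S \<inter> T = {}"
    and "p \<circ> q = p' \<circ> q'"
  shows "p = p'" "q = q'"
proof -
  show "p = p'"
  proof
    fix x show "p x = p' x"
      using permutes_union(2)[OF assms(1,2,5), of x] permutes_union(2)[OF assms(3,4,5), of x]
        assms(6) permutes_not_in[OF assms(1), of x] permutes_not_in[OF assms(3), of x]
      by (cases "x \<in> S") auto
  qed
  show "q = q'"
  proof
    fix x show "q x = q' x"
      using permutes_union(3)[OF assms(1,2,5), of x] permutes_union(3)[OF assms(3,4,5), of x]
        assms(6) permutes_not_in[OF assms(2), of x] permutes_not_in[OF assms(4), of x]
      by (cases "x \<in> T") auto
  qed
qed

text \<open>An injective map of a finite set into itself is onto, so \<open>S\<close> and its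
  complement in \<open>X\<close> are both preserved and \<open>p\<close> restricts to each.\<close>

lemma permutes_split:
  assumes p: "p permutes X" and S: "S \<subseteq> X" "finite S" "p ` S \<subseteq> S"
  obtains p1 p2 where "p1 permutes S" "p2 permutes X - S" "p = p1 \<circ> p2"
proof -
  have image: "p ` S = S"
    using endo_inj_surj[OF S(2,3)] permutes_inj_on[OF p] by blast
  have image': "p ` (X - S) = X - S"
    using image_set_diff[OF permutes_inj[OF p], of X S] permutes_image[OF p] image by simp
  have p1: "restrict_id p S permutes S"
    by (intro permutes_restrict_id bij_betw_imageI permutes_inj_on[OF p] image)
  have p2: "restrict_id p (X - S) permutes X - S"
    by (intro permutes_restrict_id bij_betw_imageI permutes_inj_on[OF p] image')
  have "p = restrict_id p S \<circ> restrict_id p (X - S)"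
  proof
    fix x
    show "p x = (restrict_id p S \<circ> restrict_id p (X - S)) x"
      using permutes_union(2,3)[OF p1 p2, of x] permutes_not_in[OF p, of x] S(1)
      by (cases "x \<in> S"; cases "x \<in> X") auto
  qed
  then show thesis using p1 p2 that by blast
qed

lemma cycle_count_union:
  assumes p: "p permutes S" and q: "q permutes T" and disj: "S \<inter> T = {}" and fin: "finite S" "finite T"
  shows "cycle_count (p \<circ> q) (S \<union> T) = cycle_count p S + cycle_count q T"
proof -
  have 1: "orbit (p \<circ> q) x = orbit p x" if "x \<in> S" for x
    using that permutes_in_image[OF p] permutes_union(2)[OF p q disj]
    by (intro orbit_cong0[where A = S]) (auto simp del: o_apply)
  have 2: "orbit (p \<circ> q) x = orbit q x" if "x \<in> T" for x
    using that permutes_in_image[OF q] permutes_union(3)[OF p q disj]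
    by (intro orbit_cong0[where A = T]) (auto simp del: o_apply)
  have "orbit (p \<circ> q) ` (S \<union> T) = orbit p ` S \<union> orbit q ` T"
    unfolding image_Un using 1 2 by (simp cong: image_cong)
  moreover have "orbit p ` S \<inter> orbit q ` T = {}"
  proof -
    have "orbit p x \<noteq> orbit q y" if "x \<in> S" "y \<in> T" for x y
      using orbit.base[of p x] permutes_orbit_subset[OF p that(1)]
        permutes_orbit_subset[OF q that(2)] disj by auto
    then show ?thesis by blast
  qed
  ultimately show ?thesis
    using fin by (simp add: cycle_count_def card_Un_disjoint)
qed

subsection \<open>Components of dart pairs\<close>

definition involutions :: "'a set \<Rightarrow> ('a \<Rightarrow> 'a) set"
  where "involutions X = {t. t permutes X \<and> (\<forall>d\<in>X. t d \<noteq> d \<and> t (t d) = d)}"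

lemma finite_involutions: "finite X \<Longrightarrow> finite (involutions X)"
  by (rule finite_subset[OF _ finite_permutations[of X]]) (auto simp: involutions_def)

lemma involutions_union:
  assumes "S \<inter> T = {}" "p permutes S" "q permutes T"
  shows "p \<circ> q \<in> involutions (S \<union> T) \<longleftrightarrow> p \<in> involutions S \<and> q \<in> involutions T"
proof -
  note u = permutes_union[OF assms(2,3,1)]
  have "p d \<in> S" if "d \<in> S" for d using that permutes_in_image[OF assms(2)] by simp
  moreover have "q d \<in> T" if "d \<in> T" for d using that permutes_in_image[OF assms(3)] by simp
  ultimately show ?thesis
    using u assms(2,3) by (auto simp: involutions_def ball_Un simp del: o_apply)
qed

text \<open>Sort the involutions by the partner \<open>b\<close> of a chosen point \<open>a\<close>;
  the rest is an arbitrary fixed point free involution of the other \<open>card X - 2\<close>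
  points.\<close>

lemma card_involutions:
  assumes "finite X"
  shows "card (involutions X) = involution_count (card X)"
  using assms
proof (induction "card X" arbitrary: X rule: less_induct)
  case less
  show ?case
  proof (cases "X = {}")
    case True
    then show ?thesis by (auto simp: involutions_def)
  next
    case False
    then obtain a where a: "a \<in> X" by blast
    have pos: "card X > 0" using False less.prems by (simp add: card_gt_0_iff)
    have fiber: "card {t \<in> involutions X. t a = b} = involution_count (card X - 2)" if b: "b \<in> X - {a}" for b
    proof -
      let ?S = "{a, b}"
      have S: "?S \<subseteq> X" "a \<noteq> b" "?S \<union> (X - ?S) = X" "?S \<inter> (X - ?S) = {}" using a b by auto
      have tr: "transpose a b permutes ?S" by (rule permutes_swap_id) auto
      have tr_inv: "transpose a b \<in> involutions ?S" using tr S(2) by (auto simp: involutions_def)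
      have "bij_betw (\<lambda>q. transpose a b \<circ> q) (involutions (X - ?S)) {t \<in> involutions X. t a = b}"
      proof (rule bij_betw_imageI)
        show "inj_on (\<lambda>q. transpose a b \<circ> q) (involutions (X - ?S))"
        proof (rule inj_onI)
          fix q q' assume "q \<in> involutions (X - ?S)" "q' \<in> involutions (X - ?S)"
            "transpose a b \<circ> q = transpose a b \<circ> q'"
          then show "q = q'"
            using permutes_union_eq(2)[OF tr _ tr _ S(4)] by (simp add: involutions_def)
        qed
        show "(\<lambda>q. transpose a b \<circ> q) ` involutions (X - ?S) = {t \<in> involutions X. t a = b}"
        proof (intro equalityI subsetI)
          fix t assume "t \<in> (\<lambda>q. transpose a b \<circ> q) ` involutions (X - ?S)"
          then obtain q where q: "q \<in> involutions (X - ?S)" and t: "t = transpose a b \<circ> q" by blast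
          then have qp: "q permutes X - ?S" by (simp add: involutions_def)
          have "t \<in> involutions X"
            using involutions_union[OF S(4) tr qp] tr_inv q unfolding S(3) t by blast
          moreover have "t a = b"
            using permutes_union(2)[OF tr qp S(4), of a] unfolding t by simp
          ultimately show "t \<in> {t \<in> involutions X. t a = b}" by blast
        next
          fix t assume t: "t \<in> {t \<in> involutions X. t a = b}"
          then have perm: "t permutes X" and tb: "t b = a" using a by (auto simp: involutions_def)
          have "t ` ?S \<subseteq> ?S" using t tb by auto
          then obtain p q where pq: "p permutes ?S" "q permutes X - ?S" "t = p \<circ> q"
            using permutes_split[OF perm S(1)] by blast
          have "p a = b" using permutes_union(2)[OF pq(1,2) S(4), of a] t pq(3) by simp
          then have "p = transpose a b" using pq(1) S(2) by (auto simp: permutes_doubleton_iff)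
          moreover have "q \<in> involutions (X - ?S)"
            using involutions_union[OF S(4) pq(1,2)] t unfolding S(3) pq(3) by blast
          ultimately show "t \<in> (\<lambda>q. transpose a b \<circ> q) ` involutions (X - ?S)"
            using pq(3) by blast
        qed
      qed
      then have "card {t \<in> involutions X. t a = b} = card (involutions (X - ?S))"
        by (simp add: bij_betw_same_card)
      moreover have "card (X - ?S) = card X - 2"
        using S(1,2) less.prems by (simp add: card_Diff_subset)
      moreover have "card X - 2 < card X" using pos by simp
      ultimately show ?thesis using less.hyps[of "X - ?S"] less.prems by simp
    qed
    have "(\<Sum>b\<in>X - {a}. \<Sum>t | t \<in> involutions X \<and> t a = b. 1) = (\<Sum>t\<in>involutions X. 1::nat)"
    proof (rule sum.group)
      show "(\<lambda>t. t a) ` involutions X \<subseteq> X - {a}"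
        using a by (auto simp: involutions_def permutes_in_image)
    qed (use less.prems finite_involutions in auto)
    then have "card (involutions X) = (\<Sum>b\<in>X - {a}. card {t \<in> involutions X. t a = b})"
      by simp
    also have "\<dots> = (card X - 1) * involution_count (card X - 2)"
      using a less.prems by (simp add: fiber)
    also have "\<dots> = involution_count (card X)"
      using pos by (cases "card X" rule: involution_count.cases) auto
    finally show ?thesis .
  qed
qed

text \<open>A possibly disconnected map on the darts \<open>X\<close>: rotation first, edge reversal
  second.\<close>

definition dart_pairs :: "'a set \<Rightarrow> (('a \<Rightarrow> 'a) \<times> ('a \<Rightarrow> 'a)) set"
  where "dart_pairs X = {p. p permutes X} \<times> involutions X"

definition stable_set :: "('a \<Rightarrow> 'a) \<times> ('a \<Rightarrow> 'a) \<Rightarrow> 'a set \<Rightarrow> bool"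
  where "stable_set p T \<longleftrightarrow> fst p ` T \<subseteq> T \<and> snd p ` T \<subseteq> T"

text \<open>For permutations of a finite set this is transitivity, but the fixed dart \<open>r\<close> makes the
  decomposition into the component of \<open>r\<close> and the rest immediate.\<close>

definition generated_by :: "'a set \<Rightarrow> 'a \<Rightarrow> ('a \<Rightarrow> 'a) \<times> ('a \<Rightarrow> 'a) \<Rightarrow> bool"
  where "generated_by X r p \<longleftrightarrow> (\<forall>T\<subseteq>X. r \<in> T \<and> stable_set p T \<longrightarrow> T = X)"

definition pair_sum :: "'b::comm_semiring_1 \<Rightarrow> 'a set \<Rightarrow> 'b"
  where "pair_sum c X = (\<Sum>p\<in>dart_pairs X. c ^ cycle_count (fst p) X)"

definition connected_pair_sum :: "'b::comm_semiring_1 \<Rightarrow> 'a set \<Rightarrow> 'a \<Rightarrow> 'b"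
  where "connected_pair_sum c X r =
    (\<Sum>p | p \<in> dart_pairs X \<and> generated_by X r p. c ^ cycle_count (fst p) X)"

lemma finite_dart_pairs: "finite X \<Longrightarrow> finite (dart_pairs X)"
  by (simp add: dart_pairs_def finite_permutations finite_involutions)

lemma pair_sum_eq:
  assumes "finite X"
  shows "pair_sum c X = of_nat (involution_count (card X)) * pochhammer c (card X)"
proof -
  have "pair_sum c X = (\<Sum>s | s permutes X. \<Sum>t\<in>involutions X. c ^ cycle_count s X)"
    unfolding pair_sum_def dart_pairs_def sum.cartesian_product by (simp add: case_prod_beta)
  also have "\<dots> = of_nat (involution_count (card X)) * (\<Sum>s | s permutes X. c ^ cycle_count s X)"
    by (simp add: card_involutions[OF assms] sum_distrib_left)
  finally show ?thesis by (simp add: sum_cycle_count[OF assms])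
qed

definition component :: "'a set \<Rightarrow> 'a \<Rightarrow> ('a \<Rightarrow> 'a) \<times> ('a \<Rightarrow> 'a) \<Rightarrow> 'a set"
  where "component X r p = \<Inter> {T. T \<subseteq> X \<and> r \<in> T \<and> stable_set p T}"

lemma stable_dart_pairs: "p \<in> dart_pairs X \<Longrightarrow> stable_set p X"
  by (auto simp: dart_pairs_def involutions_def stable_set_def permutes_in_image)

lemma component_props:
  assumes "p \<in> dart_pairs X" "r \<in> X"
  shows "component X r p \<subseteq> X" "r \<in> component X r p" "stable_set p (component X r p)"
proof -
  show "component X r p \<subseteq> X"
    unfolding component_def using stable_dart_pairs[OF assms(1)] assms(2) by (intro Inter_lower) simp
  show "r \<in> component X r p"
    by (simp add: component_def)
  show "stable_set p (component X r p)"
    unfolding component_def stable_set_def by blast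
qed

text \<open>Whether the component of \<open>r\<close> equals \<open>S\<close> is decided by the
  action of \<open>p\<close> on \<open>S\<close> alone, which leaves the action on the rest of
  \<open>X\<close> free.\<close>

lemma component_eq_iff:
  assumes "p \<in> dart_pairs X" "r \<in> S" "S \<subseteq> X"
  shows "component X r p = S \<longleftrightarrow> stable_set p S \<and> generated_by S r p"
proof
  have r: "r \<in> X" using assms by blast
  assume *: "component X r p = S"
  have "T = S" if "T \<subseteq> S" "r \<in> T" "stable_set p T" for T
  proof -
    have "component X r p \<subseteq> T"
      unfolding component_def by (rule Inter_lower) (use that assms(3) in blast)
    then show ?thesis using that(1) * by blast
  qed
  then show "stable_set p S \<and> generated_by S r p"
    using component_props(3)[OF assms(1) r] * by (simp add: generated_by_def)
next
  have r: "r \<in> X" using assms by blast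
  assume *: "stable_set p S \<and> generated_by S r p"
  then have "component X r p \<subseteq> S"
    unfolding component_def by (intro Inter_lower) (use assms in blast)
  then show "component X r p = S"
    using * component_props(2,3)[OF assms(1) r] by (simp add: generated_by_def)
qed

section \<open>Splitting off the component of a chosen dart\<close>

definition pair_union ::
    "('a \<Rightarrow> 'a) \<times> ('a \<Rightarrow> 'a) \<Rightarrow> ('a \<Rightarrow> 'a) \<times> ('a \<Rightarrow> 'a) \<Rightarrow> ('a \<Rightarrow> 'a) \<times> ('a \<Rightarrow> 'a)"
  where "pair_union p q = (fst p \<circ> fst q, snd p \<circ> snd q)"

lemma component_split_bij:
  assumes fin: "finite X" and S: "S \<subseteq> X" and r: "r \<in> S"
  shows "bij_betw (\<lambda>(p, q). pair_union p q)
    ({p \<in> dart_pairs S. generated_by S r p} \<times> dart_pairs (X - S))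
    {p \<in> dart_pairs X. component X r p = S}" (is "bij_betw ?f ?A ?B")
proof (rule bij_betw_imageI)
  have disj: "S \<inter> (X - S) = {}" and un: "S \<union> (X - S) = X" using S by auto
  \<comment> \<open>Subsets of \<open>S\<close> are moved by the first pair only, so stability and
    generation inside \<open>S\<close> can be tested on that pair.\<close>
  have agree: "T \<subseteq> S \<Longrightarrow> stable_set (pair_union p q) T \<longleftrightarrow> stable_set p T"
    if "p \<in> dart_pairs S" "q \<in> dart_pairs (X - S)" for p q T
  proof -
    assume T: "T \<subseteq> S"
    have "(fst p \<circ> fst q) x = fst p x" "(snd p \<circ> snd q) x = snd p x" if "x \<in> T" for x
      using permutes_union(2)[OF _ _ disj, of _ _ x] \<open>p \<in> _\<close> \<open>q \<in> _\<close> T that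
      by (auto simp: dart_pairs_def involutions_def simp del: o_apply)
    then have "(fst p \<circ> fst q) ` T = fst p ` T" "(snd p \<circ> snd q) ` T = snd p ` T"
      by (simp_all cong: image_cong)
    then show ?thesis by (simp add: stable_set_def pair_union_def)
  qed
  show "inj_on ?f ?A"
  proof (rule inj_onI)
    fix P Q assume "P \<in> ?A" "Q \<in> ?A" "?f P = ?f Q"
    then show "P = Q"
      using permutes_union_eq[OF _ _ _ _ disj, of "fst (fst P)" "fst (snd P)" "fst (fst Q)" "fst (snd Q)"]
        permutes_union_eq[OF _ _ _ _ disj, of "snd (fst P)" "snd (snd P)" "snd (fst Q)" "snd (snd Q)"]
      by (simp add: dart_pairs_def involutions_def pair_union_def case_prod_beta mem_Times_iff prod_eq_iff)
  qed
  show "?f ` ?A = ?B"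
  proof (intro equalityI subsetI)
    fix p assume "p \<in> ?f ` ?A"
    then obtain p1 p2 where p: "p = pair_union p1 p2" and p1: "p1 \<in> dart_pairs S" "generated_by S r p1"
      and p2: "p2 \<in> dart_pairs (X - S)" by auto
    have perm: "fst p1 permutes S" "snd p1 permutes S" "fst p2 permutes X - S" "snd p2 permutes X - S"
      using p1 p2 by (auto simp: dart_pairs_def involutions_def)
    have pX: "p \<in> dart_pairs X"
      using permutes_union(1)[OF perm(1,3) disj] involutions_union[OF disj perm(2,4)] p1(1) p2
      unfolding un by (auto simp: dart_pairs_def p pair_union_def)
    have "stable_set p S" "generated_by S r p"
      using agree[OF p1(1) p2] stable_dart_pairs[OF p1(1)] p1(2) by (auto simp: p generated_by_def)
    then show "p \<in> ?B" using component_eq_iff[OF pX r S] pX by blast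
  next
    fix p assume "p \<in> ?B"
    then have pX: "p \<in> dart_pairs X" and st: "stable_set p S" and gen: "generated_by S r p"
      using component_eq_iff[OF _ r S, of p] by blast+
    obtain s t where st_eq: "p = (s, t)" by (cases p)
    have perm: "s permutes X" "t permutes X" using pX by (auto simp: dart_pairs_def involutions_def st_eq)
    have finS: "finite S" using fin S by (rule rev_finite_subset)
    obtain s1 s2 where s: "s1 permutes S" "s2 permutes X - S" "s = s1 \<circ> s2"
      using permutes_split[OF perm(1) S finS] st by (auto simp: stable_set_def st_eq)
    obtain t1 t2 where t: "t1 permutes S" "t2 permutes X - S" "t = t1 \<circ> t2"
      using permutes_split[OF perm(2) S finS] st by (auto simp: stable_set_def st_eq)
    have "t1 \<in> involutions S" "t2 \<in> involutions (X - S)"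
      using involutions_union[OF disj t(1,2)] pX unfolding un by (auto simp: dart_pairs_def st_eq t(3))
    then have d: "(s1, t1) \<in> dart_pairs S" "(s2, t2) \<in> dart_pairs (X - S)"
      using s by (auto simp: dart_pairs_def)
    have p_eq: "p = pair_union (s1, t1) (s2, t2)" by (simp add: pair_union_def st_eq s(3) t(3))
    have "generated_by S r (s1, t1)"
      using gen agree[OF d] by (auto simp: generated_by_def p_eq)
    then show "p \<in> ?f ` ?A"
      using d p_eq by (intro image_eqI[of _ _ "((s1, t1), (s2, t2))"]) auto
  qed
qed

text \<open>Group the pairs by the component \<open>S\<close> of \<open>r\<close>. The parts on
  \<open>S\<close> and on \<open>X - S\<close> are chosen independently, and cycle counts add, so
  weights multiply.\<close>

lemma pair_sum_component:
  assumes fin: "finite X" and r: "r \<in> X"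
  shows "pair_sum c X = (\<Sum>S | S \<subseteq> X \<and> r \<in> S. connected_pair_sum c S r * pair_sum c (X - S))"
proof -
  let ?I = "{S. S \<subseteq> X \<and> r \<in> S}"
  have "pair_sum c X = (\<Sum>S\<in>?I. \<Sum>p | p \<in> dart_pairs X \<and> component X r p = S. c ^ cycle_count (fst p) X)"
    unfolding pair_sum_def
  proof (rule sum.group[symmetric])
    show "finite ?I" by (rule finite_subset[of _ "Pow X"]) (use fin in auto)
    show "component X r ` dart_pairs X \<subseteq> ?I" using component_props[OF _ r] by blast
  qed (rule finite_dart_pairs[OF fin])
  also have "\<dots> = (\<Sum>S\<in>?I. connected_pair_sum c S r * pair_sum c (X - S))"
  proof (rule sum.cong)
    fix S assume "S \<in> ?I"
    then have S: "S \<subseteq> X" "r \<in> S" by auto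
    have disj: "S \<inter> (X - S) = {}" and un: "S \<union> (X - S) = X" using S by auto
    have finS: "finite S" "finite (X - S)" using fin S by (auto intro: finite_subset)
    let ?G = "{p \<in> dart_pairs S. generated_by S r p}"
    have "(\<Sum>p | p \<in> dart_pairs X \<and> component X r p = S. c ^ cycle_count (fst p) X)
      = (\<Sum>(p, q)\<in>?G \<times> dart_pairs (X - S). c ^ cycle_count (fst (pair_union p q)) X)"
      using sum.reindex_bij_betw[OF component_split_bij[OF fin S], of "\<lambda>p. c ^ cycle_count (fst p) X"]
      by (simp add: case_prod_beta)
    also have "\<dots> = (\<Sum>(p, q)\<in>?G \<times> dart_pairs (X - S). c ^ cycle_count (fst p) S * c ^ cycle_count (fst q) (X - S))"
    proof (rule sum.cong, simp, clarsimp simp: pair_union_def)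
      fix s t u v assume "(s, t) \<in> dart_pairs S" "(u, v) \<in> dart_pairs (X - S)"
      then have "s permutes S" "u permutes X - S" by (auto simp: dart_pairs_def)
      from cycle_count_union[OF this disj finS]
      show "c ^ cycle_count (s \<circ> u) X = c ^ cycle_count s S * c ^ cycle_count u (X - S)"
        unfolding un by (simp add: power_add)
    qed
    also have "\<dots> = connected_pair_sum c S r * pair_sum c (X - S)"
      unfolding connected_pair_sum_def pair_sum_def sum_product sum.cartesian_product
      by (simp add: Collect_conj_eq)
    finally show "(\<Sum>p | p \<in> dart_pairs X \<and> component X r p = S. c ^ cycle_count (fst p) X)
      = connected_pair_sum c S r * pair_sum c (X - S)" .
  qed simp
  finally show ?thesis .
qed

lemma sum_subsets_containing:
  fixes f :: "nat \<Rightarrow> 'b::comm_semiring_1"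
  assumes fin: "finite X" and r: "r \<in> X" and card: "card X = Suc n"
  shows "(\<Sum>S | S \<subseteq> X \<and> r \<in> S. f (card S)) = (\<Sum>j\<le>n. of_nat (n choose j) * f (Suc j))"
proof -
  let ?Y = "X - {r}"
  have finY: "finite ?Y" and cardY: "card ?Y = n" using assms by simp_all
  have "bij_betw (insert r) (Pow ?Y) {S. S \<subseteq> X \<and> r \<in> S}"
  proof (rule bij_betw_imageI)
    show "inj_on (insert r) (Pow ?Y)" by (rule inj_onI) blast
    show "insert r ` Pow ?Y = {S. S \<subseteq> X \<and> r \<in> S}"
    proof (intro equalityI subsetI)
      fix S assume "S \<in> {S. S \<subseteq> X \<and> r \<in> S}"
      then show "S \<in> insert r ` Pow ?Y" by (intro image_eqI[of _ _ "S - {r}"]) auto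
    qed (use r in auto)
  qed
  then have "(\<Sum>S | S \<subseteq> X \<and> r \<in> S. f (card S)) = (\<Sum>T\<in>Pow ?Y. f (card (insert r T)))"
    by (rule sum.reindex_bij_betw[symmetric])
  also have "\<dots> = (\<Sum>T\<in>Pow ?Y. f (Suc (card T)))"
  proof (rule sum.cong)
    fix T assume "T \<in> Pow ?Y"
    then have "finite T" "r \<notin> T" using finY by (auto intro: finite_subset)
    then show "f (card (insert r T)) = f (Suc (card T))" by simp
  qed simp
  also have "\<dots> = (\<Sum>j\<le>n. \<Sum>T | T \<in> Pow ?Y \<and> card T = j. f (Suc (card T)))"
    using finY cardY by (intro sum.group[symmetric]) (auto intro: card_mono)
  also have "\<dots> = (\<Sum>j\<le>n. of_nat (n choose j) * f (Suc j))"
    using n_subsets[OF finY] by (intro sum.cong) (simp_all add: cardY)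
  finally show ?thesis .
qed

text \<open>The decomposition by components determines the connected sums recursively, as the
  unknown occurs only in the term \<open>S = X\<close>, with factor 1. The closed form satisfies the
  same recursion by \<open>pair_count_recurrence\<close>, so strong induction leaves only these two
  terms to compare.\<close>

lemma connected_pair_sum_field:
  fixes c :: "'b::field_char_0"
  assumes "finite X" "r \<in> X" "card X = Suc n"
  shows "connected_pair_sum c X r = c * fact n * path_sum (c + 1) (Suc n) 0"
  using assms
proof (induction n arbitrary: X rule: less_induct)
  case (less n)
  \<comment> \<open>\<open>?g k\<close> is the claimed contribution of a component with
    \<open>k\<close> darts. A component contains \<open>r\<close>, so \<open>k\<close> is positive
    and \<open>k - 1\<close> does not truncate.\<close>
  let ?g = "\<lambda>k. c * fact (k - 1) * path_sum (c + 1) k 0 *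
    (of_nat (involution_count (Suc n - k)) * pochhammer c (Suc n - k))"
  let ?I = "{S. S \<subseteq> X \<and> r \<in> S}"
  have finI: "finite ?I" by (rule finite_subset[of _ "Pow X"]) (use less.prems in auto)
  have X: "X \<in> ?I" using less.prems by simp
  have eq: "connected_pair_sum c S r * pair_sum c (X - S) = ?g (card S)" if "S \<in> ?I - {X}" for S
  proof -
    have S: "S \<subset> X" "r \<in> S" using that by auto
    have finS: "finite S" using S less.prems by (auto intro: finite_subset)
    then have "card S < Suc n" using psubset_card_mono[OF less.prems(1) S(1)] less.prems by simp
    moreover have "card S > 0" using S(2) finS by (auto simp: card_gt_0_iff)
    then obtain m where m: "card S = Suc m" by (cases "card S") auto
    ultimately have "connected_pair_sum c S r = c * fact m * path_sum (c + 1) (Suc m) 0"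
      using less.IH[of m S] finS S(2) by simp
    moreover have "card (X - S) = Suc n - card S"
      using S finS less.prems by (simp add: card_Diff_subset)
    ultimately show ?thesis
      using less.prems by (simp add: pair_sum_eq m del: path_sum.simps)
  qed
  have "(\<Sum>S\<in>?I. ?g (card S)) = (\<Sum>j\<le>n. of_nat (n choose j) * ?g (Suc j))"
    by (rule sum_subsets_containing[OF less.prems])
  also have "\<dots> = pair_sum c X"
    using pair_count_recurrence[of n c] less.prems
    by (simp add: pair_sum_eq mult.assoc del: path_sum.simps pochhammer_Suc involution_count.simps)
  also have "\<dots> = (\<Sum>S\<in>?I. connected_pair_sum c S r * pair_sum c (X - S))"
    by (rule pair_sum_component[OF less.prems(1,2)])
  finally have "?g (card X) + (\<Sum>S\<in>?I - {X}. ?g (card S)) =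
      connected_pair_sum c X r * pair_sum c (X - X)
      + (\<Sum>S\<in>?I - {X}. connected_pair_sum c S r * pair_sum c (X - S))"
    unfolding sum.remove[OF finI X] .
  also have "(\<Sum>S\<in>?I - {X}. connected_pair_sum c S r * pair_sum c (X - S)) = (\<Sum>S\<in>?I - {X}. ?g (card S))"
    by (rule sum.cong[OF refl eq])
  finally have "?g (card X) = connected_pair_sum c X r * pair_sum c (X - X)"
    by (rule add_right_imp_eq)
  then show ?case
    using less.prems by (simp add: pair_sum_eq del: path_sum.simps)
qed

text \<open>The recurrence involves quotients by factorials, so it is proved over a field and carried over
  to polynomials by evaluation at integers.\<close>

lemma connected_pair_sum_hom:
  fixes f :: "'b::comm_semiring_1 \<Rightarrow> 'c::comm_semiring_1" and X :: "'a set"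
  assumes "\<And>a b. f (a + b) = f a + f b" "\<And>a b. f (a * b) = f a * f b" "f 0 = 0" "f 1 = 1"
  shows "f (connected_pair_sum c X r) = connected_pair_sum (f c) X r"
proof -
  have "f (a ^ k) = f a ^ k" for a k by (induction k) (simp_all add: assms)
  moreover have "f (sum g A) = (\<Sum>a\<in>A. f (g a))" for g and A :: "(('a \<Rightarrow> 'a) \<times> ('a \<Rightarrow> 'a)) set"
    by (induction A rule: infinite_finite_induct) (simp_all add: assms)
  ultimately show ?thesis by (simp add: connected_pair_sum_def)
qed

lemma connected_pair_sum_eq:
  assumes "finite X" "r \<in> X" "card X = Suc n"
  shows "connected_pair_sum cvar X r = cvar * of_nat (fact n) * path_sum (cvar + 1) (Suc n) 0"
    (is "?l = ?r")
proof -
  have "poly ?l x = poly ?r x" for x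
  proof -
    \<comment> \<open>The reals are a field of characteristic 0 containing the integers, so equal
      images give back equal integer values.\<close>
    define ev :: "int poly \<Rightarrow> real" where "ev p = of_int (poly p x)" for p
    have hom: "\<And>a b. ev (a + b) = ev a + ev b" "\<And>a b. ev (a * b) = ev a * ev b" "ev 0 = 0" "ev 1 = 1"
      by (simp_all add: ev_def)
    have "ev ?l = connected_pair_sum (ev cvar) X r"
      by (rule connected_pair_sum_hom[of ev, OF hom])
    also have "\<dots> = ev cvar * fact n * path_sum (ev cvar + 1) (Suc n) 0"
      by (rule connected_pair_sum_field[OF assms])
    also have "path_sum (ev cvar + 1) (Suc n) 0 = ev (path_sum (cvar + 1) (Suc n) 0)"
      by (simp only: path_sum_hom[of ev, OF hom] hom)
    also have "fact n = ev (of_nat (fact n))"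
    proof -
      have "ev (of_nat k) = of_nat k" for k by (induction k) (simp_all add: hom)
      then have "ev (of_nat (fact n)) = of_nat (fact n)" .
      then show ?thesis unfolding of_nat_fact by (rule sym)
    qed
    finally have "ev ?l = ev ?r" by (simp only: hom(2))
    then show ?thesis unfolding ev_def by (simp only: of_int_eq_iff)
  qed
  \<comment> \<open>Polynomials over the infinite domain of integers are determined by their
    values.\<close>
  then have "poly ?l = poly ?r" by (rule ext)
  then show ?thesis unfolding poly_eq_poly_eq_iff .
qed

section \<open>Labelled rooted maps as connected dart pairs\<close>

lemma reachable_iff_generated_by:
  fixes X :: "'a set"
  assumes p: "(s, t) \<in> dart_pairs X" and r: "r \<in> X" and fin: "finite X"
  shows "(\<forall>d\<in>X. \<forall>e\<in>X. (d, e) \<in> {(x, y). x \<in> X \<and> (y = s x \<or> y = t x)}\<^sup>*) \<longleftrightarrow> generated_by X r (s, t)"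
    (is "?L \<longleftrightarrow> ?R")
proof
  let ?E = "{(x, y). x \<in> X \<and> (y = s x \<or> y = t x)}"
  assume L: ?L
  show ?R
    unfolding generated_by_def
  proof (intro allI impI)
    fix T assume T: "T \<subseteq> X" "r \<in> T \<and> stable_set (s, t) T"
    have "e \<in> T" if "(r, e) \<in> ?E\<^sup>*" for e
      using that by induction (use T in \<open>auto simp: stable_set_def\<close>)
    then show "T = X" using L r T(1) by blast
  qed
next
  let ?E = "{(x, y). x \<in> X \<and> (y = s x \<or> y = t x)}"
  assume R: ?R
  have perm: "s permutes X" "t permutes X" using p by (auto simp: dart_pairs_def involutions_def)
  show ?L
  proof
    fix d assume d: "d \<in> X"
    define T where "T = {e \<in> X. (d, e) \<in> ?E\<^sup>*}"
    have dT: "d \<in> T" and TX: "T \<subseteq> X" using d by (auto simp: T_def)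
    have st: "s ` T \<subseteq> T" "t ` T \<subseteq> T"
      using permutes_in_image[OF perm(1)] permutes_in_image[OF perm(2)]
      by (auto simp: T_def intro: rtrancl_into_rtrancl)
    have finT: "finite T" using TX fin by (rule finite_subset)
    \<comment> \<open>By finiteness the complement of a closed set is closed as well. If
      \<open>r\<close> were not reachable from \<open>d\<close>, the complement of \<open>T\<close>
      would be a closed set containing \<open>r\<close>, hence all of \<open>X\<close>, although
      \<open>d\<close> is in \<open>T\<close>.\<close>
    have st': "u ` (X - T) \<subseteq> X - T" if "u permutes X" "u ` T \<subseteq> T" for u
    proof -
      have "u ` T = T" using endo_inj_surj[OF finT that(2)] permutes_inj_on[OF that(1)] by blast
      then show ?thesis
        using image_set_diff[OF permutes_inj[OF that(1)], of X T] permutes_image[OF that(1)] by simp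
    qed
    have "r \<in> T"
    proof (rule ccontr)
      assume "r \<notin> T"
      then have "X - T = X"
        using R r st'[OF perm(1) st(1)] st'[OF perm(2) st(2)] by (simp add: generated_by_def stable_set_def)
      then show False using d dT by blast
    qed
    then have "T = X" using R TX st by (simp add: generated_by_def stable_set_def)
    then show "\<forall>e\<in>X. (d, e) \<in> ?E\<^sup>*" by (auto simp: T_def)
  qed
qed

text \<open>The additional factor stands for the head of the root edge, so that all vertices count
  alike and the root no longer matters.\<close>

lemma cvar_map_weight:
  assumes M: "is_rooted_map M" and root: "root_dart M = Some r"
  shows "cvar * map_weight M = cvar ^ cycle_count (rot M) (darts M)"
proof -
  have fin: "finite (vertices M)" and head: "opp M r \<in> darts M"
    using M root by (auto simp: is_rooted_map_def vertices_def permutes_in_image)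
  let ?h = "orbit (rot M) (opp M r)"
  have h: "?h \<in> vertices M" using head by (simp add: vertices_def)
  have "map_weight M = (\<Prod>v\<in>vertices M - {?h}. if v = ?h then 1 else cvar)"
    unfolding map_weight_def root option.case by (subst prod.remove[OF fin h]) simp
  also have "\<dots> = (\<Prod>v\<in>vertices M - {?h}. cvar)" by (rule prod.cong) auto
  also have "\<dots> = cvar ^ (card (vertices M) - 1)" using h fin by simp
  finally have "cvar * map_weight M = cvar ^ Suc (card (vertices M) - 1)" by simp
  also have "Suc (card (vertices M) - 1) = card (vertices M)"
    using card_gt_0_iff[of "vertices M"] fin h by auto
  finally show ?thesis by (simp add: cycle_count_def vertices_def)
qed

text \<open>With at least one edge the root dart cannot be \<open>None\<close>, and connectedness
  can be tested from the root by \<open>reachable_iff_generated_by\<close>.\<close>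

lemma rooted_maps_bij:
  assumes "n > 0"
  shows "bij_betw (\<lambda>(r, s, t). \<lparr>darts = {..<2 * n}, rot = s, opp = t, root_dart = Some r\<rparr>)
    (SIGMA r:{..<2 * n}. {p \<in> dart_pairs {..<2 * n}. generated_by {..<2 * n} r p}) (rooted_maps n)"
    (is "bij_betw ?f ?A ?B")
proof (rule bij_betw_imageI)
  let ?X = "{..<2 * n}"
  show "inj_on ?f ?A" by (rule inj_onI) auto
  have iff: "is_rooted_map \<lparr>darts = ?X, rot = s, opp = t, root_dart = Some r\<rparr> \<longleftrightarrow>
      r \<in> ?X \<and> (s, t) \<in> dart_pairs ?X \<and> generated_by ?X r (s, t)" for r s t
  proof (cases "r \<in> ?X \<and> (s, t) \<in> dart_pairs ?X")
    case True
    then show ?thesis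
      using reachable_iff_generated_by[of s t ?X r]
      by (simp add: is_rooted_map_def) (auto simp: dart_pairs_def involutions_def)
  next
    case False
    then show ?thesis by (auto simp: is_rooted_map_def dart_pairs_def involutions_def)
  qed
  show "?f ` ?A = ?B"
  proof (intro equalityI subsetI)
    fix M assume "M \<in> ?f ` ?A"
    then show "M \<in> ?B" using iff by (auto simp: rooted_maps_def)
  next
    fix M assume M: "M \<in> ?B"
    then obtain r where "root_dart M = Some r"
      using assms by (auto simp: rooted_maps_def is_rooted_map_def lessThan_empty_iff split: option.splits)
    then have eq: "M = \<lparr>darts = ?X, rot = rot M, opp = opp M, root_dart = Some r\<rparr>"
      using M by (simp add: rooted_maps_def)
    then have "(r, rot M, opp M) \<in> ?A"
      using iff[of "rot M" "opp M" r] M by (simp add: rooted_maps_def)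
    then show "M \<in> ?f ` ?A" using eq by (intro image_eqI[of _ _ "(r, rot M, opp M)"]) auto
  qed
qed

text \<open>Each of the \<open>2 * n\<close> roots contributes \<open>fact (2 * n - 1)\<close> times
  the path sum, which makes up the full factorial; the factor \<open>cvar\<close> added for the head
  vertex cancels.\<close>

lemma labelled_sum:
  assumes "n > 0"
  shows "(\<Sum>M\<in>rooted_maps n. map_weight M) = of_nat (fact (2 * n)) * path_sum (cvar + 1) (2 * n) 0"
proof -
  let ?X = "{..<2 * n}"
  let ?f = "\<lambda>(r, s, t). \<lparr>darts = ?X, rot = s, opp = t, root_dart = Some r\<rparr>"
  let ?A = "SIGMA r:?X. {p \<in> dart_pairs ?X. generated_by ?X r p}"
  obtain m where m: "2 * n = Suc m" using assms by (cases "2 * n") auto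
  have fin: "finite ?X" by simp
  have "cvar * (\<Sum>M\<in>rooted_maps n. map_weight M) = (\<Sum>x\<in>?A. cvar * map_weight (?f x))"
    unfolding sum_distrib_left by (rule sum.reindex_bij_betw[OF rooted_maps_bij[OF assms], symmetric])
  also have "\<dots> = (\<Sum>(r, p)\<in>?A. cvar ^ cycle_count (fst p) ?X)"
  proof (rule sum.cong)
    fix x assume x: "x \<in> ?A"
    obtain r s t where rst: "x = (r, s, t)" by (cases x)
    have "is_rooted_map (?f x)"
      using bij_betw_apply[OF rooted_maps_bij[OF assms] x] by (simp add: rooted_maps_def)
    from cvar_map_weight[OF this, of r]
    show "cvar * map_weight (?f x) = (case x of (r, p) \<Rightarrow> cvar ^ cycle_count (fst p) ?X)"
      by (simp add: rst)
  qed simp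
  also have "\<dots> = (\<Sum>r\<in>?X. connected_pair_sum cvar ?X r)"
    unfolding connected_pair_sum_def using finite_dart_pairs[OF fin]
    by (subst sum.Sigma) auto
  also have "\<dots> = (\<Sum>r\<in>?X. cvar * of_nat (fact m) * path_sum (cvar + 1) (2 * n) 0)"
    using connected_pair_sum_eq[OF fin _ , of _ m] by (intro sum.cong) (simp_all only: m card_lessThan)
  also have "\<dots> = cvar * (of_nat (fact (2 * n)) * path_sum (cvar + 1) (2 * n) 0)"
  proof -
    have "(of_nat (fact (2 * n)) :: int poly) = of_nat (2 * n) * of_nat (fact m)"
      unfolding m by (simp only: fact_Suc of_nat_mult of_nat_id)
    then show ?thesis by (simp only: sum_constant card_lessThan mult_ac)
  qed
  finally show ?thesis by simp
qed

subsection \<open>Labelled and unlabelled rooted maps\<close>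

text \<open>The permutations of the darts act on labelled rooted maps by conjugation. The orbits are
  the isomorphism classes and the action is free, which gives the class sizes.\<close>

definition relabel :: "('d \<Rightarrow> 'd) \<Rightarrow> 'd rooted_map \<Rightarrow> 'd rooted_map"
  where "relabel p M = \<lparr>darts = darts M, rot = p \<circ> rot M \<circ> inv p, opp = p \<circ> opp M \<circ> inv p,
    root_dart = map_option p (root_dart M)\<rparr>"

lemma relabel_simps [simp]:
  "darts (relabel p M) = darts M"
  "root_dart (relabel p M) = map_option p (root_dart M)"
  by (simp_all add: relabel_def)

lemma relabel_apply:
  assumes "p permutes X"
  shows "rot (relabel p M) (p d) = p (rot M d)" "opp (relabel p M) (p d) = p (opp M d)"
  using permutes_inverses(2)[OF assms] by (simp_all add: relabel_def)

lemma map_iso_relabel: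
  assumes p: "p permutes darts M"
  shows "map_iso M (relabel p M)"
  unfolding map_iso_def
  by (rule exI[of _ p]) (simp add: relabel_apply[OF p] permutes_imp_bij[OF p])

lemma is_rooted_map_relabel:
  assumes M: "is_rooted_map M" and p: "p permutes darts M"
  shows "is_rooted_map (relabel p M)"
proof -
  let ?X = "darts M" and ?N = "relabel p M"
  let ?R = "\<lambda>M. {(x, y). x \<in> darts M \<and> (y = rot M x \<or> y = opp M x)}"
  have perm: "rot M permutes ?X" "opp M permutes ?X" using M by (simp_all add: is_rooted_map_def)
  have image: "\<exists>d'\<in>?X. d = p d'" if "d \<in> ?X" for d
    using that permutes_image[OF p] by blast
  have pX: "p d \<in> ?X \<longleftrightarrow> d \<in> ?X" for d by (rule permutes_in_image[OF p])
  have inj: "p d = p e \<longleftrightarrow> d = e" for d e using permutes_inj[OF p] by (simp add: inj_eq)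
  have "rot ?N permutes ?X" "opp ?N permutes ?X"
    unfolding relabel_def using perm permutes_inv[OF p] p by (auto intro!: permutes_compose)
  moreover have "opp ?N d \<noteq> d \<and> opp ?N (opp ?N d) = d" if "d \<in> ?X" for d
  proof -
    obtain d' where "d' \<in> ?X" "d = p d'" using image[OF \<open>d \<in> ?X\<close>] by blast
    then show ?thesis using M by (simp add: relabel_apply[OF p] inj is_rooted_map_def)
  qed
  moreover have "(d, e) \<in> (?R ?N)\<^sup>*" if "d \<in> ?X" "e \<in> ?X" for d e
  proof -
    obtain d' e' where de: "d' \<in> ?X" "e' \<in> ?X" "d = p d'" "e = p e'"
      using image[OF \<open>d \<in> ?X\<close>] image[OF \<open>e \<in> ?X\<close>] by blast
    then have "(d', e') \<in> (?R M)\<^sup>*" using M by (simp add: is_rooted_map_def)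
    then have "(p d', p e') \<in> (?R ?N)\<^sup>*"
    proof induction
      case (step y z)
      then have "(p y, p z) \<in> ?R ?N" by (auto simp: relabel_apply[OF p] pX)
      then show ?case using step.IH by (rule rtrancl_into_rtrancl[rotated])
    qed simp
    then show ?thesis using de by simp
  qed
  moreover have "case root_dart ?N of None \<Rightarrow> ?X = {} | Some r \<Rightarrow> r \<in> ?X"
    using M by (auto simp: is_rooted_map_def pX split: option.splits)
  ultimately show ?thesis
    using M unfolding is_rooted_map_def relabel_simps by blast
qed

text \<open>An isomorphism is only specified on the darts. Its extension by the identity is a
  permutation, and the conjugated functions agree everywhere because rotation and reversal are the
  identity outside the darts as well.\<close>

lemma map_iso_imp_relabel:
  assumes M: "is_rooted_map M" and N: "is_rooted_map N" and eq: "darts N = darts M"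
    and iso: "map_iso M N"
  shows "\<exists>p. p permutes darts M \<and> N = relabel p M"
proof -
  let ?X = "darts M"
  obtain f where bij: "bij_betw f ?X ?X"
    and comm: "\<And>d. d \<in> ?X \<Longrightarrow> f (rot M d) = rot N (f d) \<and> f (opp M d) = opp N (f d)"
    and rt: "map_option f (root_dart M) = root_dart N"
    using iso eq unfolding map_iso_def by metis
  define p where "p = restrict_id f ?X"
  have p: "p permutes ?X" unfolding p_def by (rule permutes_restrict_id[OF bij])
  have pf: "p d = f d" if "d \<in> ?X" for d using that by (simp add: p_def)
  have perm: "rot M permutes ?X" "opp M permutes ?X" "rot N permutes ?X" "opp N permutes ?X"
    using M N eq by (simp_all add: is_rooted_map_def)
  have conj: "v = p \<circ> u \<circ> inv p"
    if u: "u permutes ?X" and v: "v permutes ?X" and uv: "\<And>d. d \<in> ?X \<Longrightarrow> f (u d) = v (f d)" for u v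
  proof
    fix y
    obtain x where x: "y = p x" using permutes_surj[OF p] by blast
    show "v y = (p \<circ> u \<circ> inv p) y"
    proof (cases "x \<in> ?X")
      case True
      then have "p (u x) = v (p x)"
        using uv[OF True] permutes_in_image[OF u, of x] by (simp add: pf)
      then show ?thesis by (simp add: x permutes_inverses(2)[OF p])
    next
      case False
      then have "u x = x" "v (p x) = p x"
        using permutes_not_in[OF u] permutes_not_in[OF v] permutes_not_in[OF p] by simp_all
      then show ?thesis by (simp add: x permutes_inverses(2)[OF p])
    qed
  qed
  have "root_dart N = map_option p (root_dart M)"
    using rt M pf unfolding is_rooted_map_def by (cases "root_dart M") auto
  then have "N = relabel p M"
    using conj[OF perm(1,3)] conj[OF perm(2,4)] comm eq by (simp add: relabel_def)
  then show ?thesis using p by blast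
qed

text \<open>An automorphism fixing the root fixes every dart reachable from it, hence everything.\<close>

lemma relabel_inj:
  assumes M: "is_rooted_map M" and p: "p permutes darts M" and q: "q permutes darts M"
    and eq: "relabel p M = relabel q M"
  shows "p = q"
proof (cases "root_dart M")
  case None
  then have "darts M = {}" using M by (simp add: is_rooted_map_def)
  then show ?thesis using p q by simp
next
  case (Some r)
  then have r: "r \<in> darts M" using M by (simp add: is_rooted_map_def)
  have "p r = q r" using arg_cong[OF eq, of root_dart] Some by simp
  have "p d = q d" if "d \<in> darts M" for d
  proof -
    have "(r, d) \<in> {(x, y). x \<in> darts M \<and> (y = rot M x \<or> y = opp M x)}\<^sup>*"
      using M r that by (simp add: is_rooted_map_def)
    then show ?thesis
    proof induction
      case (step y z)
      then show ?case
        using relabel_apply[OF p, of M y] relabel_apply[OF q, of M y] eq by auto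
    qed (rule \<open>p r = q r\<close>)
  qed
  then show ?thesis
    using permutes_not_in[OF p] permutes_not_in[OF q] by (metis ext)
qed

text \<open>The relabellings of \<open>M\<close> exhaust the class and are pairwise distinct, so
  they correspond to the permutations of the darts.\<close>

lemma card_iso_class:
  assumes M: "M \<in> rooted_maps n"
  shows "card (iso_rel n `` {M}) = fact (2 * n)"
proof -
  let ?X = "{..<2 * n}"
  have rM: "is_rooted_map M" and dM: "darts M = ?X" using M by (auto simp: rooted_maps_def)
  have "bij_betw (\<lambda>p. relabel p M) {p. p permutes ?X} (iso_rel n `` {M})"
  proof (rule bij_betw_imageI)
    show "inj_on (\<lambda>p. relabel p M) {p. p permutes ?X}"
      using relabel_inj[OF rM] by (auto simp: dM intro!: inj_onI)
    show "(\<lambda>p. relabel p M) ` {p. p permutes ?X} = iso_rel n `` {M}"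
    proof (intro equalityI subsetI)
      fix N assume "N \<in> (\<lambda>p. relabel p M) ` {p. p permutes ?X}"
      then show "N \<in> iso_rel n `` {M}"
        using M is_rooted_map_relabel[OF rM] map_iso_relabel[of _ M]
        by (auto simp: iso_rel_def rooted_maps_def dM)
    next
      fix N assume "N \<in> iso_rel n `` {M}"
      then show "N \<in> (\<lambda>p. relabel p M) ` {p. p permutes ?X}"
        using map_iso_imp_relabel[OF rM, of N] by (auto simp: iso_rel_def rooted_maps_def dM)
    qed
  qed
  then have "card (iso_rel n `` {M}) = card {p. p permutes ?X}"
    by (simp add: bij_betw_same_card)
  then show ?thesis by (simp add: card_permutations)
qed

lemma finite_rooted_maps: "finite (rooted_maps n)"
proof -
  let ?X = "{..<2 * n}"
  let ?f = "\<lambda>(s, t, r). \<lparr>darts = ?X, rot = s, opp = t, root_dart = r\<rparr>"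
  have "rooted_maps n \<subseteq> ?f ` ({p. p permutes ?X} \<times> {p. p permutes ?X} \<times> insert None (Some ` ?X))"
  proof
    fix M assume "M \<in> rooted_maps n"
    then show "M \<in> ?f ` ({p. p permutes ?X} \<times> {p. p permutes ?X} \<times> insert None (Some ` ?X))"
      by (intro image_eqI[of _ _ "(rot M, opp M, root_dart M)"])
        (auto simp: rooted_maps_def is_rooted_map_def split: option.splits)
  qed
  then show ?thesis
    by (rule finite_subset) (intro finite_imageI finite_cartesian_product finite_permutations; simp)
qed

text \<open>Every class consists of \<open>fact (2 * n)\<close> labelled maps of equal weight, so
  the sum over a class is this factorial times the weight of its representative.\<close>

lemma rooted_map_gf_labelled:
  "(\<Sum>M\<in>rooted_maps n. map_weight M) = of_nat (fact (2 * n)) * rooted_map_gf n"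
proof -
  let ?Q = "rooted_maps n // iso_rel n"
  have fin: "finite C" if "C \<in> ?Q" for C
    using that finite_rooted_maps[of n] Union_quotient[OF equiv_iso_rel[of n]]
    by (metis Union_upper finite_subset)
  have "(\<Sum>M\<in>rooted_maps n. map_weight M) = (\<Sum>M\<in>\<Union>?Q. map_weight M)"
    by (simp only: Union_quotient[OF equiv_iso_rel])
  also have "\<dots> = (\<Sum>C\<in>?Q. \<Sum>M\<in>C. map_weight M)"
    using quotient_disj[OF equiv_iso_rel[of n]] fin by (intro sum.Union_disjoint[unfolded comp_def]) blast+
  also have "\<dots> = (\<Sum>C\<in>?Q. of_nat (fact (2 * n)) * map_weight (SOME M. M \<in> C))"
  proof (rule sum.cong)
    fix C assume C: "C \<in> ?Q"
    then obtain M where M: "M \<in> rooted_maps n" "C = iso_rel n `` {M}" by (rule quotientE)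
    let ?N = "SOME M. M \<in> C"
    have "M \<in> C" using M equiv_class_self[OF equiv_iso_rel] by blast
    then have "?N \<in> C" by (rule someI)
    have "map_weight N = map_weight ?N" if "N \<in> C" for N
      using congruentD[OF map_weight_respects] that \<open>?N \<in> C\<close> C
        quotient_eq_iff[OF equiv_iso_rel C C] by blast
    then have "(\<Sum>M\<in>C. map_weight M) = (\<Sum>M\<in>C. map_weight ?N)" by (intro sum.cong) auto
    also have "\<dots> = of_nat (fact (2 * n)) * map_weight ?N"
      unfolding M(2) sum_constant card_iso_class[OF M(1)] ..
    finally show "(\<Sum>M\<in>C. map_weight M) = of_nat (fact (2 * n)) * map_weight ?N" .
  qed simp
  also have "\<dots> = of_nat (fact (2 * n)) * rooted_map_gf n"
    by (simp only: rooted_map_gf_def sum_distrib_left)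
  finally show ?thesis .
qed

text \<open>The map consisting of a single vertex has no root dart and escapes the count by dart
  pairs, so it is treated separately.\<close>

lemma rooted_map_gf_0: "rooted_map_gf 0 = 1"
proof -
  let ?M = "\<lparr>darts = {}, rot = id, opp = id, root_dart = None\<rparr> :: nat rooted_map"
  have "M = ?M" if "M \<in> rooted_maps 0" for M
    using that by (auto simp: rooted_maps_def is_rooted_map_def split: option.splits)
  moreover have "?M \<in> rooted_maps 0"
    by (simp add: rooted_maps_def is_rooted_map_def)
  ultimately have "rooted_maps 0 = {?M}" by blast
  then have "(\<Sum>M\<in>rooted_maps 0. map_weight M) = 1"
    by (simp add: map_weight_def)
  then show ?thesis using rooted_map_gf_labelled[of 0] by simp
qed

lemma rooted_map_gf_eq: "rooted_map_gf n = path_sum (cvar + 1) (2 * n) 0"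
proof (cases "n = 0")
  case True
  then show ?thesis by (simp add: rooted_map_gf_0)
next
  case False
  then have "of_nat (fact (2 * n)) * rooted_map_gf n = of_nat (fact (2 * n)) * path_sum (cvar + 1) (2 * n) 0"
    using labelled_sum[of n] rooted_map_gf_labelled[of n] by simp
  moreover have "(of_nat (fact (2 * n)) :: int poly) \<noteq> 0"
    by (simp only: of_nat_eq_0_iff fact_nonzero not_False_eq_True)
  ultimately show ?thesis by (simp only: mult_cancel_left simp_thms)
qed

theorem mainTheorem8:
  fixes n :: nat
  shows "rooted_map_gf n = pcompose (moment (2 * n)) (cvar + 1)
    \<and> connected_matching_gf (n + 1) = pcompose (moment (2 * n)) (cvar + 1)
    \<and> matching_gf n = pcompose (moment (2 * n)) (cvar + 1)"
  unfolding moment_shift rooted_map_gf_eq connected_matching_gf_eq matching_gf_eq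
  by (intro conjI refl)

end
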